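(* There is a constant $C>0$, independent of the mesh size $h$, of the location of $\Gamma$ relative to the mesh, and of $\beta^\pm$, such that for $j=0,1$ and all $p\in\mathbb{Q}_1$, $$|\mathcal{C}_T(p)|_{H^j(T_1)}\le C|p|_{H^j(T_1)},\qquad |\mathcal{C}_T^{-1}(p)|_{H^j(T_1)}\le C\frac{\beta^+}{\beta^-}|p|_{H^j(T_1)},$$ for every interface element $T$ of one of the following types: Type III, if $|A_4D_4|\le\frac12|A_4A_3|$ or $|A_2D_1|\le\frac12|A_2A_1|$ or $|A_6D_2|\le\frac12|A_6A_5|$ or $|A_8D_3|\le\frac12|A_8A_7|$; Type V.
   Context: Setting and mesh: $\Omega\subset\mathbb{R}^3$ is an open cuboid domain, separated into two subdomains $\Omega^-$ and $\Omega^+$ by a closed $C^2$ surface $\Gamma\subset\Omega$ (the interface). The coefficients are constants $\beta^\pm>0$ on $\Omega^\pm$, with the convention that $\beta^+$ denotes the larger and $\beta^-$ the smaller coefficient. $\kappa$ is the maximal (principal) curvature of $\Gamma$, and $r_\Gamma$ (the reach) is the largest $r$ such that the segments $N_X(r)$, $X\in\Gamma$, of length $2r$, centered at $X$ and perpendicular to $\Gamma$, are pairwise disjoint. $\mathcal{T}_h$ is a Cartesian mesh of $\Omega$ consisting of cuboids, where $h$ denotes the maximum length of all the cuboids. An element is an interface element if its vertices do not all lie on the same side of $\Gamma$. Standing assumptions: $h<r_\Gamma/(3\sqrt3)$; $h\kappa\le 0.0288$; $\Gamma$ cannot intersect a mesh edge at more than one point; $\Gamma$ cannot intersect a mesh face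 at more than two edges. Vertices and types: the vertices of the cuboid $T$ are labelled $A_1,\dots,A_8$ so that, up to rotation/reflection, with $e_1,e_2,e_3$ the edge directions and $\ell_1,\ell_2,\ell_3$ the corresponding edge lengths of $T$, $A_2=A_1+\ell_1e_1$, $A_3=A_1+\ell_2e_2$, $A_4=A_1+\ell_1e_1+\ell_2e_2$, and $A_{k+4}=A_k+\ell_3e_3$ for $k=1,\dots,4$. $\Gamma$ cuts $T$ into two subelements: $T_1\ni A_1$ and $T_2\ni A_8$. Type III: four intersection points of $\Gamma$ with edges of $T$, on four parallel edges, $D_1\in A_1A_2$, $D_2\in A_5A_6$, $D_3\in A_7A_8$, $D_4\in A_3A_4$, so that $T_1\ni A_1,A_3,A_5,A_7$ and $T_2\ni A_2,A_4,A_6,A_8$. Type V: six intersection points, each of $T_1,T_2$ containing four vertices forming a vertex together with its three neighbours. Approximate plane and extension operator: fix a triangle whose vertices are three of the intersection points of $\Gamma$ with edges of $T$ and whose maximal angle is at most $135^\circ$ (such a triangle always exists; for Type III take $\triangle D_1D_4D_3$). $\tau_T$ is its plane, $\bar{\mathbf{n}}$ a unit normal to $\tau_T$, $F_T$ the centroid of the triangle, $L(X)=(X-F_T)\cdot\bar{\mathbf{n}}$. With $\mathbb{Q}_1=\mathrm{Span}\{1,x,y,z,xy,xz,yz,xyz\}$, the operator $\mathcal{C}_T:\mathbb{Q}_1\to\mathbb{Q}_1$ and its inverse are $$\mathcal{C}_T(p)=p+\left(\tfrac{\beta^-}{\beta^+}-1\right)(\nabla p(F_T)\cdot\bar{\mathbf{n}})L,\qquad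 \mathcal{C}_T^{-1}(p)=p+\left(\tfrac{\beta^+}{\beta^-}-1\right)(\nabla p(F_T)\cdot\bar{\mathbf{n}})L.$$ $|\cdot|_{H^0}$ is the $L^2$ norm.
   Formalization: The mesh is assumed shape-regular: the ratio of longest to shortest side of each cuboid is at most an arbitrary fixed σ, and C may depend on σ. For arbitrarily flat cuboids no uniform constant exists (sides 1, ε, 1, interface x = 1/2 + y + z/4, p = y). *)

theory Defs
  imports "HOL-Analysis.Analysis"
begin

section \<open>Surfaces: tangents, normals, curvature, reach\<close>

definition C2_on :: "(real^3) set \<Rightarrow> (real^3 \<Rightarrow> real) \<Rightarrow> bool" where
  "C2_on U f \<longleftrightarrow>
     (\<exists>(g :: real^3 \<Rightarrow> real^3) (H :: real^3 \<Rightarrow> ((real^3) \<Rightarrow>\<^sub>L (real^3))).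
        (\<forall>x\<in>U. (f has_derivative (\<lambda>v. g x \<bullet> v)) (at x)) \<and>
        (\<forall>x\<in>U. (g has_derivative blinfun_apply (H x)) (at x)) \<and>
        continuous_on U H)"

text \<open>A closed (compact, without boundary) embedded \<open>C\<^sup>2\<close> surface: locally the zero set of a
  \<open>C\<^sup>2\<close> function whose differential does not vanish.\<close>

definition closed_C2_surface :: "(real^3) set \<Rightarrow> bool" where
  "closed_C2_surface \<Gamma> \<longleftrightarrow> compact \<Gamma> \<and>
     (\<forall>X\<in>\<Gamma>. \<exists>U f. open U \<and> X \<in> U \<and> C2_on U f \<and>
        (\<forall>Y\<in>U. frechet_derivative f (at Y) \<noteq> (\<lambda>v. 0)) \<and>
        \<Gamma> \<inter> U = {Y\<in>U. f Y = 0})"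

text \<open>Tangent vectors are velocities of curves on the surface.\<close>

definition tangent_space :: "(real^3) set \<Rightarrow> real^3 \<Rightarrow> (real^3) set" where
  "tangent_space \<Gamma> X =
     {v. \<exists>\<epsilon>>0. \<exists>\<gamma> :: real \<Rightarrow> real^3.
           \<gamma> 0 = X \<and> \<gamma> ` {-\<epsilon><..<\<epsilon>} \<subseteq> \<Gamma> \<and> (\<gamma> has_vector_derivative v) (at 0)}"

definition unit_normal :: "(real^3) set \<Rightarrow> real^3 \<Rightarrow> real^3 \<Rightarrow> bool" where
  "unit_normal \<Gamma> X n \<longleftrightarrow> norm n = 1 \<and> (\<forall>v\<in>tangent_space \<Gamma> X. n \<bullet> v = 0)"

text \<open>Principal curvatures are the eigenvalues of the differential of a local Gauss map \<open>\<nu>\<close>.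
  The derivative of \<open>\<nu>\<close> is taken within \<open>\<Gamma>\<close>; this determines it on tangent vectors, which is
  all that is used. The sign depends on the choice of the normal, and only absolute values
  enter below.\<close>

definition principal_curvatures :: "(real^3) set \<Rightarrow> real^3 \<Rightarrow> real set" where
  "principal_curvatures \<Gamma> X =
     {k. \<exists>U \<nu> D v. open U \<and> X \<in> U \<and> continuous_on (\<Gamma> \<inter> U) \<nu> \<and>
           (\<forall>Y\<in>\<Gamma> \<inter> U. unit_normal \<Gamma> Y (\<nu> Y)) \<and>
           (\<nu> has_derivative D) (at X within \<Gamma>) \<and>
           v \<in> tangent_space \<Gamma> X \<and> v \<noteq> 0 \<and> D v = k *\<^sub>R v}"

text \<open>Extended reals are used for the suprema below so that they need no boundedness
  side conditions; for a closed \<open>C\<^sup>2\<close> surface both are finite.\<close>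

definition max_curvature :: "(real^3) set \<Rightarrow> ereal" where
  "max_curvature \<Gamma> = Sup {ereal \<bar>k\<bar> | k. \<exists>X\<in>\<Gamma>. k \<in> principal_curvatures \<Gamma> X}"

definition normal_segment :: "(real^3) set \<Rightarrow> real^3 \<Rightarrow> real \<Rightarrow> (real^3) set" where
  "normal_segment \<Gamma> X r = {X + t *\<^sub>R n | t n. \<bar>t\<bar> \<le> r \<and> unit_normal \<Gamma> X n}"

definition reach :: "(real^3) set \<Rightarrow> ereal" where
  "reach \<Gamma> = Sup {ereal r | r. 0 \<le> r \<and>
     (\<forall>X\<in>\<Gamma>. \<forall>Y\<in>\<Gamma>. X \<noteq> Y \<longrightarrow> normal_segment \<Gamma> X r \<inter> normal_segment \<Gamma> Y r = {})}"


section \<open>The interface problem\<close>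

text \<open>The last two conjuncts say that each of the two subdomains borders on the whole interface.\<close>

definition interface_domain ::
    "real^3 \<Rightarrow> real^3 \<Rightarrow> (real^3) set \<Rightarrow> (real^3) set \<Rightarrow> (real^3) set \<Rightarrow> bool" where
  "interface_domain a b \<Gamma> \<Omega>m \<Omega>p \<longleftrightarrow>
     (\<forall>i. a $ i < b $ i) \<and> closed_C2_surface \<Gamma> \<and> \<Gamma> \<subseteq> box a b \<and>
     open \<Omega>m \<and> connected \<Omega>m \<and> \<Omega>m \<noteq> {} \<and>
     open \<Omega>p \<and> connected \<Omega>p \<and> \<Omega>p \<noteq> {} \<and>
     \<Omega>m \<inter> \<Omega>p = {} \<and> \<Omega>m \<union> \<Omega>p = box a b - \<Gamma> \<and>
     \<Gamma> \<subseteq> closure \<Omega>m \<and> \<Gamma> \<subseteq> closure \<Omega>p"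

text \<open>Points off \<open>\<Gamma>\<close> on the side of the subdomain \<open>S\<close>. The closure is needed because mesh
  vertices may lie on the boundary of the (open) cuboid.\<close>

definition side :: "(real^3) set \<Rightarrow> (real^3) set \<Rightarrow> (real^3) set" where
  "side \<Gamma> S = closure S - \<Gamma>"


section \<open>Cartesian meshes\<close>

text \<open>A cuboid is given by its lower and upper corner.\<close>

type_synonym cuboid = "(real^3) \<times> (real^3)"

definition cell :: "cuboid \<Rightarrow> (real^3) set" where
  "cell T = cbox (fst T) (snd T)"

definition side_length :: "cuboid \<Rightarrow> 3 \<Rightarrow> real" where
  "side_length T i = snd T $ i - fst T $ i"

definition vertices :: "cuboid \<Rightarrow> (real^3) set" where
  "vertices T = {x. \<forall>i. x $ i = fst T $ i \<or> x $ i = snd T $ i}"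

definition edges :: "cuboid \<Rightarrow> (real^3) set set" where
  "edges T = {closed_segment x y | x y.
     x \<in> vertices T \<and> y \<in> vertices T \<and> (\<exists>!i. x $ i \<noteq> y $ i)}"

definition faces :: "cuboid \<Rightarrow> (real^3) set set" where
  "faces T = {{x \<in> cell T. x $ i = c} | i c. c = fst T $ i \<or> c = snd T $ i}"

text \<open>The mesh generated by the grid coordinates \<open>G i\<close> in direction \<open>i\<close>: all cuboids whose
  sides join consecutive grid coordinates.\<close>

definition grid_cells :: "(3 \<Rightarrow> real set) \<Rightarrow> cuboid set" where
  "grid_cells G = {T. \<forall>i. fst T $ i \<in> G i \<and> snd T $ i \<in> G i \<and> fst T $ i < snd T $ i \<and>
     G i \<inter> {fst T $ i<..<snd T $ i} = {}}"

definition cartesian_mesh :: "real^3 \<Rightarrow> real^3 \<Rightarrow> cuboid set \<Rightarrow> bool" where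
  "cartesian_mesh a b \<T> \<longleftrightarrow>
     (\<exists>G. (\<forall>i. finite (G i) \<and> a $ i \<in> G i \<and> b $ i \<in> G i \<and> G i \<subseteq> {a $ i..b $ i}) \<and>
          \<T> = grid_cells G)"

definition mesh_size :: "cuboid set \<Rightarrow> real" where
  "mesh_size \<T> = Max {side_length T i | T i. T \<in> \<T>}"

text \<open>Shape regularity bounds the aspect ratio; for arbitrarily flat cuboids no uniform constant
  exists in the \<open>L\<^sup>2\<close> estimate, so constants may depend on \<open>\<sigma>\<close>.\<close>

definition shape_regular :: "real \<Rightarrow> cuboid set \<Rightarrow> bool" where
  "shape_regular \<sigma> \<T> \<longleftrightarrow> (\<forall>T\<in>\<T>. \<forall>i j. side_length T i \<le> \<sigma> * side_length T j)"

definition mesh_assumptions :: "(real^3) set \<Rightarrow> cuboid set \<Rightarrow> bool" where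
  "mesh_assumptions \<Gamma> \<T> \<longleftrightarrow>
     ereal (mesh_size \<T>) < reach \<Gamma> / ereal (3 * sqrt 3) \<and>
     ereal (mesh_size \<T>) * max_curvature \<Gamma> \<le> ereal 0.0288 \<and>
     (\<forall>T\<in>\<T>. \<forall>e\<in>edges T. \<forall>X\<in>e \<inter> \<Gamma>. \<forall>Y\<in>e \<inter> \<Gamma>. X = Y) \<and>
     (\<forall>T\<in>\<T>. \<forall>f\<in>faces T. card {e\<in>edges T. e \<subseteq> f \<and> e \<inter> \<Gamma> \<noteq> {}} \<le> 2)"


section \<open>Interface elements and their types\<close>

definition interface_element ::
    "(real^3) set \<Rightarrow> (real^3) set \<Rightarrow> (real^3) set \<Rightarrow> cuboid \<Rightarrow> bool" where
  "interface_element \<Gamma> \<Omega>m \<Omega>p T \<longleftrightarrow>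
     \<not> vertices T \<subseteq> side \<Gamma> \<Omega>m \<and> \<not> vertices T \<subseteq> side \<Gamma> \<Omega>p"

text \<open>\<open>A 1, \<dots>, A 8\<close> enumerate the vertices in the standard order with respect to a frame
  \<open>e 1, e 2, e 3\<close> of signed coordinate directions; \<open>\<pi>\<close> gives the coordinate axes. All
  rotations and reflections of the standard labelling are thereby allowed.\<close>

definition vertex_labelling :: "cuboid \<Rightarrow> (nat \<Rightarrow> real^3) \<Rightarrow> bool" where
  "vertex_labelling T A \<longleftrightarrow>
     A ` {1..8} = vertices T \<and>
     (\<exists>(\<pi> :: 3 \<Rightarrow> 3) (e :: 3 \<Rightarrow> real^3) (l :: 3 \<Rightarrow> real). bij \<pi> \<and>
        (\<forall>m. (e m = axis (\<pi> m) 1 \<or> e m = - axis (\<pi> m) 1) \<and> l m = side_length T (\<pi> m)) \<and>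
        A 2 = A 1 + l 1 *\<^sub>R e 1 \<and>
        A 3 = A 1 + l 2 *\<^sub>R e 2 \<and>
        A 4 = A 1 + l 1 *\<^sub>R e 1 + l 2 *\<^sub>R e 2 \<and>
        (\<forall>k\<in>{1..4}. A (k + 4) = A k + l 3 *\<^sub>R e 3))"

definition edge_points :: "(real^3) set \<Rightarrow> cuboid \<Rightarrow> (real^3) set" where
  "edge_points \<Gamma> T = \<Union> (edges T) \<inter> \<Gamma>"

text \<open>The part of \<open>T\<close> on the side of the subdomain \<open>S\<close>.\<close>

definition subelement :: "(real^3) set \<Rightarrow> (real^3) set \<Rightarrow> cuboid \<Rightarrow> (real^3) set" where
  "subelement \<Gamma> S T = cell T \<inter> side \<Gamma> S"

text \<open>In the two types below, \<open>T1\<close> and \<open>T2\<close> are the two subelements.\<close>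

definition type_III ::
    "(real^3) set \<Rightarrow> cuboid \<Rightarrow> (real^3) set \<Rightarrow> (real^3) set \<Rightarrow>
     (nat \<Rightarrow> real^3) \<Rightarrow> (nat \<Rightarrow> real^3) \<Rightarrow> bool" where
  "type_III \<Gamma> T T1 T2 A D \<longleftrightarrow>
     edge_points \<Gamma> T = {D 1, D 2, D 3, D 4} \<and>
     D 1 \<in> closed_segment (A 1) (A 2) \<and> D 2 \<in> closed_segment (A 5) (A 6) \<and>
     D 3 \<in> closed_segment (A 7) (A 8) \<and> D 4 \<in> closed_segment (A 3) (A 4) \<and>
     {A 1, A 3, A 5, A 7} \<subseteq> T1 \<and> {A 2, A 4, A 6, A 8} \<subseteq> T2"

text \<open>The neighbours of \<open>A 1\<close> are \<open>A 2, A 3, A 5\<close>; those of \<open>A 8\<close> are \<open>A 4, A 6, A 7\<close>.\<close>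

definition type_V ::
    "(real^3) set \<Rightarrow> cuboid \<Rightarrow> (real^3) set \<Rightarrow> (real^3) set \<Rightarrow> (nat \<Rightarrow> real^3) \<Rightarrow> bool" where
  "type_V \<Gamma> T T1 T2 A \<longleftrightarrow>
     card (edge_points \<Gamma> T) = 6 \<and>
     {A 1, A 2, A 3, A 5} \<subseteq> T1 \<and> {A 4, A 6, A 7, A 8} \<subseteq> T2"


section \<open>Approximate plane and extension operator\<close>

definition vertex_angle :: "real^3 \<Rightarrow> real^3 \<Rightarrow> real^3 \<Rightarrow> real" where
  "vertex_angle P Q R = arccos (((Q - P) \<bullet> (R - P)) / (norm (Q - P) * norm (R - P)))"

definition max_angle_le :: "real^3 \<Rightarrow> real^3 \<Rightarrow> real^3 \<Rightarrow> real \<Rightarrow> bool" where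
  "max_angle_le P Q R \<theta> \<longleftrightarrow>
     vertex_angle P Q R \<le> \<theta> \<and> vertex_angle Q R P \<le> \<theta> \<and> vertex_angle R P Q \<le> \<theta>"

definition plane_normal :: "(real^3) set \<Rightarrow> real^3 \<Rightarrow> bool" where
  "plane_normal \<tau> n \<longleftrightarrow> norm n = 1 \<and> (\<forall>X\<in>\<tau>. \<forall>Y\<in>\<tau>. n \<bullet> (X - Y) = 0)"

definition centroid :: "real^3 \<Rightarrow> real^3 \<Rightarrow> real^3 \<Rightarrow> real^3" where
  "centroid P Q R = (1/3) *\<^sub>R (P + Q + R)"

definition Q1 :: "(real^3 \<Rightarrow> real) set" where
  "Q1 = {p. \<exists>c :: nat \<Rightarrow> real. p = (\<lambda>X.
     c 0 + c 1 * X$1 + c 2 * X$2 + c 3 * X$3 + c 4 * (X$1 * X$2) + c 5 * (X$1 * X$3) +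
     c 6 * (X$2 * X$3) + c 7 * (X$1 * X$2 * X$3))}"

definition grad :: "(real^3 \<Rightarrow> real) \<Rightarrow> real^3 \<Rightarrow> real^3" where
  "grad p X = (\<chi> i. frechet_derivative p (at X) (axis i 1))"

definition C_op ::
    "real \<Rightarrow> real \<Rightarrow> real^3 \<Rightarrow> real^3 \<Rightarrow> (real^3 \<Rightarrow> real) \<Rightarrow> real^3 \<Rightarrow> real" where
  "C_op \<beta>m \<beta>p F n p = (\<lambda>X. p X + (\<beta>m / \<beta>p - 1) * (grad p F \<bullet> n) * ((X - F) \<bullet> n))"

definition C_op_inv ::
    "real \<Rightarrow> real \<Rightarrow> real^3 \<Rightarrow> real^3 \<Rightarrow> (real^3 \<Rightarrow> real) \<Rightarrow> real^3 \<Rightarrow> real" where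
  "C_op_inv \<beta>m \<beta>p F n p = (\<lambda>X. p X + (\<beta>p / \<beta>m - 1) * (grad p F \<bullet> n) * ((X - F) \<bullet> n))"

text \<open>The seminorm of \<open>H\<^sup>j(S)\<close> for \<open>j = 0, 1\<close> (only these values are meaningful) and smooth \<open>p\<close>.\<close>

definition H_seminorm :: "nat \<Rightarrow> (real^3) set \<Rightarrow> (real^3 \<Rightarrow> real) \<Rightarrow> real" where
  "H_seminorm j S p =
     sqrt (if j = 0 then (LINT X:S|lborel. (p X)\<^sup>2) else (LINT X:S|lborel. (norm (grad p X))\<^sup>2))"

end

theory Submission
  imports Defs
begin

text \<open>
  Both operators add to \<open>p\<close> a multiple of \<open>(grad p F \<bullet> n) * L\<close>, with a factor of modulus at most
  \<open>1\<close> and \<open>\<beta>p / \<beta>m\<close>, respectively. So it suffices to bound \<open>grad p F \<bullet> n\<close>, times the seminorm of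
  \<open>L\<close>, by the seminorm of \<open>p\<close> on \<open>T1\<close>. If \<open>T1\<close> contains a cube whose side is a fixed fraction
  (depending on the aspect ratio) of the longest side of \<open>T\<close>, this is an inverse
  estimate for polynomials (\<open>extension_stable\<close>): the value of a function in \<open>Q1\<close> at any point of \<open>T\<close> is an extrapolation, with bounded coefficients, from eight
  points that can be moved around in the cube (\<open>Q1_value_le_L2_on_cube\<close>).

  The point is therefore that the interface cannot squeeze \<open>T1\<close>. The bound on the mesh size in terms
  of the reach says that at every point of \<open>\<Gamma>\<close> there are two tangent balls of radius more than five
  times the longest side of \<open>T\<close> which \<open>\<Gamma>\<close> does not enter (\<open>tangent_ball_avoids_surface\<close>), and they lie on
  different sides (\<open>opposite_tangent_ball\<close>). The two types of elements share the following property: \<open>T\<close> has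
  a vertex \<open>V\<close> in \<open>T1\<close> such that on each of the three edges at \<open>V\<close> some point in the far half is in
  \<open>T1\<close> or on \<open>\<Gamma>\<close> (\<open>vertex_with_half_edges\<close>); in type III this is what the assumption
  on the ratio of lengths provides. If \<open>V\<close> is away from \<open>\<Gamma>\<close>, the corner at \<open>V\<close> contains the cube. Otherwise
  these three points keep the tangent ball of the opposite side from swallowing an edge, which forces
  the tangent ball of the side of \<open>T1\<close> to reach deep into \<open>T\<close> along an edge
  (\<open>corner_contains_cube\<close>).
\<close>

section \<open>Tangent balls of a surface with positive reach\<close>

text \<open>This is the condition on \<open>r\<close> whose supremum is the reach.\<close>

definition normals_disjoint :: "(real^3) set \<Rightarrow> real \<Rightarrow> bool" where
  "normals_disjoint \<Gamma> r \<longleftrightarrow>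
     (\<forall>X\<in>\<Gamma>. \<forall>Y\<in>\<Gamma>. X \<noteq> Y \<longrightarrow> normal_segment \<Gamma> X r \<inter> normal_segment \<Gamma> Y r = {})"

lemma unit_normal_uminus: "unit_normal \<Gamma> X n \<Longrightarrow> unit_normal \<Gamma> X (- n)"
  by (auto simp: unit_normal_def)

text \<open>The squared distance to \<open>Z\<close> along a curve in \<open>\<Gamma>\<close> through \<open>X\<close> is minimal at \<open>X\<close>, so its
  derivative \<open>2 (X - Z) \<bullet> v\<close> vanishes for every tangent vector \<open>v\<close>.\<close>

lemma unit_normal_towards_nearest:
  assumes X: "X \<in> \<Gamma>" and nearest: "\<And>Y. Y \<in> \<Gamma> \<Longrightarrow> dist Z X \<le> dist Z Y" and "Z \<noteq> X"
  shows "unit_normal \<Gamma> X ((1 / dist Z X) *\<^sub>R (Z - X))"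
proof -
  have "(Z - X) \<bullet> v = 0" if v: "v \<in> tangent_space \<Gamma> X" for v
  proof -
    obtain e \<gamma> where e: "e > 0" and \<gamma>0: "\<gamma> 0 = X" and im: "\<gamma> ` {-e<..<e} \<subseteq> \<Gamma>"
      and der: "(\<gamma> has_vector_derivative v) (at 0)"
      using v by (auto simp: tangent_space_def)
    have hd: "((\<lambda>t. (\<gamma> t - Z) \<bullet> (\<gamma> t - Z)) has_real_derivative 2 * ((X - Z) \<bullet> v)) (at 0)"
      using der unfolding has_vector_derivative_def has_field_derivative_def
      by (auto intro!: derivative_eq_intros simp: \<gamma>0 inner_commute algebra_simps fun_eq_iff)
    have "2 * ((X - Z) \<bullet> v) = 0"
    proof (rule DERIV_local_min[OF hd e], intro allI impI)
      fix t :: real assume "\<bar>0 - t\<bar> < e"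
      then have "dist Z X \<le> dist Z (\<gamma> t)"
        using im by (intro nearest) (auto simp: abs_if split: if_splits)
      then have "(dist (\<gamma> 0) Z)\<^sup>2 \<le> (dist (\<gamma> t) Z)\<^sup>2"
        by (simp add: \<gamma>0 dist_commute)
      then show "(\<gamma> 0 - Z) \<bullet> (\<gamma> 0 - Z) \<le> (\<gamma> t - Z) \<bullet> (\<gamma> t - Z)"
        by (simp add: dist_norm power2_norm_eq_inner)
    qed
    then show ?thesis by (simp add: inner_diff_left)
  qed
  then show ?thesis
    using \<open>Z \<noteq> X\<close> by (simp add: unit_normal_def dist_norm)
qed

text \<open>The gradient of a local defining function is orthogonal to all velocities of curves in
  \<open>\<Gamma>\<close>, because the function is constantly zero along them.\<close>

lemma closed_C2_surface_has_unit_normal: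
  assumes "closed_C2_surface \<Gamma>" and X: "X \<in> \<Gamma>"
  shows "\<exists>n. unit_normal \<Gamma> X n"
proof -
  obtain U f where U: "open U" "X \<in> U" and C2: "C2_on U f"
    and ne: "frechet_derivative f (at X) \<noteq> (\<lambda>v. 0)" and zero: "\<Gamma> \<inter> U = {Y\<in>U. f Y = 0}"
    using assms by (force simp: closed_C2_surface_def)
  obtain g where g: "(f has_derivative (\<lambda>v. g \<bullet> v)) (at X)"
    using C2 U unfolding C2_on_def by meson
  then have "g \<noteq> 0"
    using ne frechet_derivative_at[OF g] by auto
  have "g \<bullet> v = 0" if v: "v \<in> tangent_space \<Gamma> X" for v
  proof -
    obtain e \<gamma> where e: "e > 0" and \<gamma>0: "\<gamma> 0 = X" and im: "\<gamma> ` {-e<..<e} \<subseteq> \<Gamma>"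
      and der: "(\<gamma> has_vector_derivative v) (at 0)"
      using v by (auto simp: tangent_space_def)
    have "((\<lambda>t. f (\<gamma> t)) has_derivative (\<lambda>t. g \<bullet> (t *\<^sub>R v))) (at 0)"
      using has_derivative_compose[of \<gamma> "\<lambda>t. t *\<^sub>R v" 0 UNIV f "\<lambda>v. g \<bullet> v"] der g
      by (simp add: has_vector_derivative_def \<gamma>0)
    then have 1: "((\<lambda>t. f (\<gamma> t)) has_real_derivative (g \<bullet> v)) (at 0)"
      by (simp add: has_field_derivative_def mult_commute_abs)
    have "isCont \<gamma> 0"
      using der has_vector_derivative_continuous by blast
    then have "eventually (\<lambda>t. \<gamma> t \<in> U) (at 0)"
      using U by (simp add: isCont_def \<gamma>0 topological_tendstoD)
    moreover have "eventually (\<lambda>t::real. t \<in> {-e<..<e}) (at 0)"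
      using e by (intro eventually_at_in_open') auto
    ultimately have "eventually (\<lambda>t. f (\<gamma> t) = 0) (at 0)"
    proof eventually_elim
      case (elim t)
      then have "\<gamma> t \<in> \<Gamma> \<inter> U" using im by blast
      then show ?case using zero by blast
    qed
    moreover have "f (\<gamma> 0) = 0" using \<gamma>0 zero X U by blast
    ultimately have "eventually (\<lambda>t. f (\<gamma> t) = 0) (nhds 0)"
      by (simp add: eventually_nhds_conv_at)
    then have "((\<lambda>t. f (\<gamma> t)) has_real_derivative 0) (at 0) \<longleftrightarrow> ((\<lambda>t::real. 0::real) has_real_derivative 0) (at 0)"
      by (intro DERIV_cong_ev) auto
    then show ?thesis using 1 DERIV_unique by fastforce
  qed
  then have "unit_normal \<Gamma> X (g /\<^sub>R norm g)"
    using \<open>g \<noteq> 0\<close> by (simp add: unit_normal_def)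
  then show ?thesis ..
qed

text \<open>If \<open>\<Gamma>\<close> entered the ball, the point of \<open>\<Gamma>\<close> nearest to the centre would be some \<open>Y \<noteq> X\<close>,
  and the centre would lie on the normal segments of both \<open>X\<close> and \<open>Y\<close>.\<close>

lemma tangent_ball_avoids_surface:
  assumes surf: "closed_C2_surface \<Gamma>" and dj: "normals_disjoint \<Gamma> r"
    and X: "X \<in> \<Gamma>" and n: "unit_normal \<Gamma> X n" and r: "0 < r"
  shows "ball (X + r *\<^sub>R n) r \<inter> \<Gamma> = {}"
proof (rule ccontr)
  define Z where "Z = X + r *\<^sub>R n"
  assume "ball (X + r *\<^sub>R n) r \<inter> \<Gamma> \<noteq> {}"
  then obtain W where W: "W \<in> \<Gamma>" "dist Z W < r" by (auto simp: Z_def)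
  have "closed \<Gamma>" using surf by (simp add: closed_C2_surface_def compact_imp_closed)
  then obtain Y where Y: "Y \<in> \<Gamma>" and near: "\<And>Y'. Y' \<in> \<Gamma> \<Longrightarrow> dist Z Y \<le> dist Z Y'"
    using distance_attains_inf[of \<Gamma> Z] X by blast
  have dY: "dist Z Y < r" using near[OF W(1)] W(2) by simp
  have "dist Z X = r" using n r by (simp add: Z_def dist_norm unit_normal_def)
  with dY have "X \<noteq> Y" by auto
  moreover have "Z \<in> normal_segment \<Gamma> X r"
    using n r unfolding normal_segment_def Z_def by force
  moreover have "Z \<in> normal_segment \<Gamma> Y r"
  proof (cases "Z = Y")
    \<comment> \<open>here the centre itself is on the surface, and any normal at \<open>Y\<close> serves\<close>
    case True
    obtain m where "unit_normal \<Gamma> Y m"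
      using closed_C2_surface_has_unit_normal[OF surf Y] by blast
    then have "\<bar>0\<bar> \<le> r \<and> Z = Y + 0 *\<^sub>R m \<and> unit_normal \<Gamma> Y m" using True r by simp
    then show ?thesis unfolding normal_segment_def by blast
  next
    case False
    let ?m = "(1 / dist Z Y) *\<^sub>R (Z - Y)"
    have "unit_normal \<Gamma> Y ?m"
      by (rule unit_normal_towards_nearest[OF Y near False])
    moreover have "Z = Y + dist Z Y *\<^sub>R ?m" using False by simp
    moreover have "\<bar>dist Z Y\<bar> \<le> r" using dY by simp
    ultimately show ?thesis unfolding normal_segment_def by blast
  qed
  ultimately show False
    using dj X Y unfolding normals_disjoint_def by blast
qed

text \<open>The boundary of \<open>\<Omega>\<close> may cut through the tangent balls, and points of mesh cells may lie on that
  boundary; convexity of \<open>\<Omega>\<close> keeps the part of a ball inside \<open>\<Omega>\<close> connected.\<close>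

locale separating_surface =
  fixes \<Omega> \<Gamma> S1 S2 :: "(real^3) set" and r :: real
  assumes dom: "open \<Omega>" "convex \<Omega>"
    and surface: "closed_C2_surface \<Gamma>" "\<Gamma> \<subseteq> \<Omega>"
    and sides: "open S1" "open S2" "S1 \<inter> S2 = {}" "S1 \<union> S2 = \<Omega> - \<Gamma>"
    and two_sided: "\<Gamma> \<subseteq> closure S2"
    and reach_radius: "0 < r" "normals_disjoint \<Gamma> r"
begin

lemma convex_part_on_one_side:
  assumes B: "open B" "convex B" "B \<inter> \<Gamma> = {}" and V: "V \<in> B" "V \<in> closure S1"
  shows "B \<inter> \<Omega> \<subseteq> S1" "B \<inter> closure \<Omega> \<subseteq> closure S1 - \<Gamma>"
proof -
  have "B \<inter> S1 \<noteq> {}"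
    using V B(1) by (meson disjoint_iff open_Int_closure_eq_empty)
  moreover have "connected (B \<inter> \<Omega>)"
    using B dom by (simp add: convex_Int convex_connected)
  moreover have "B \<inter> \<Omega> \<subseteq> S1 \<union> S2" using sides B by blast
  moreover have "S1 \<subseteq> \<Omega>" "S2 \<subseteq> \<Omega>" using sides by auto
  ultimately have "B \<inter> \<Omega> \<inter> S2 = {}"
    using connectedD[of "B \<inter> \<Omega>" S1 S2] sides by blast
  then show *: "B \<inter> \<Omega> \<subseteq> S1" using \<open>B \<inter> \<Omega> \<subseteq> S1 \<union> S2\<close> by blast
  have "B \<inter> closure \<Omega> \<subseteq> closure (B \<inter> \<Omega>)"
    by (rule open_Int_closure_subset[OF B(1)])
  also have "\<dots> \<subseteq> closure S1" using * by (rule closure_mono)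
  finally show "B \<inter> closure \<Omega> \<subseteq> closure S1 - \<Gamma>" using B by blast
qed

text \<open>The two tangent balls at \<open>X\<close> lie on different sides. If both were in \<open>S1\<close>, then \<open>S2\<close> would have
  to approach \<open>X\<close> through the cusp between them. But a point \<open>y \<in> S2\<close> near \<open>X\<close> lies in a tangent
  ball of the same radius \<open>r\<close> at its own nearest point \<open>X'\<close>, this ball belongs to \<open>S2\<close>, and it
  is too large for the cusp: it meets one of the two balls close to \<open>X\<close>.\<close>

lemma opposite_tangent_ball:
  assumes X: "X \<in> \<Gamma>" and nrm: "unit_normal \<Gamma> X \<nu>"
    and B1: "ball (X + r *\<^sub>R \<nu>) r \<inter> \<Omega> \<subseteq> S1"
  shows "ball (X - r *\<^sub>R \<nu>) r \<inter> (closure S1 \<union> \<Gamma>) = {}"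
proof -
  have r: "r > 0" by (rule reach_radius)
  have av: "ball (X - r *\<^sub>R \<nu>) r \<inter> \<Gamma> = {}"
    using tangent_ball_avoids_surface[OF surface(1) reach_radius(2) X unit_normal_uminus[OF nrm] r] by simp
  have False if neS1: "ball (X - r *\<^sub>R \<nu>) r \<inter> closure S1 \<noteq> {}"
  proof -
    obtain V where V: "V \<in> ball (X - r *\<^sub>R \<nu>) r" "V \<in> closure S1" using neS1 by blast
    have B2: "ball (X - r *\<^sub>R \<nu>) r \<inter> \<Omega> \<subseteq> S1"
      by (rule convex_part_on_one_side(1)[OF open_ball convex_ball av V])
    obtain \<epsilon> where \<epsilon>: "\<epsilon> > 0" "ball X \<epsilon> \<subseteq> \<Omega>"
      using dom(1) surface(2) X by (meson open_contains_ball subsetD)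
    define s where "s = min (\<epsilon>/4) (r/2)"
    have s: "0 < s" "s \<le> \<epsilon>/4" "s < r" using \<epsilon> r by (auto simp: s_def)
    \<comment> \<open>the common point will be \<open>X' + s (w + \<nu>')\<close>, at distance at most \<open>\<rho> < r\<close> from the centre of the
      ball at \<open>X'\<close>; moving \<open>X'\<close> to \<open>X\<close> costs less than \<open>r - \<rho>\<close>\<close>
    define \<rho> where "\<rho> = sqrt (s\<^sup>2 + (r - s)\<^sup>2)"
    have "s\<^sup>2 + (r - s)\<^sup>2 = r\<^sup>2 - 2 * s * (r - s)" by (simp add: power2_eq_square algebra_simps)
    moreover have "2 * s * (r - s) > 0" using s by simp
    ultimately have "s\<^sup>2 + (r - s)\<^sup>2 < r\<^sup>2" by linarith
    then have \<rho>: "\<rho> < r" unfolding \<rho>_def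
      using r by (metis abs_of_pos real_sqrt_abs real_sqrt_less_iff)
    define \<delta> where "\<delta> = min (min (\<epsilon>/2) r) (r - \<rho>)"
    have \<delta>: "\<delta> > 0" "\<delta> \<le> \<epsilon>/2" "\<delta> \<le> r" "\<delta> \<le> r - \<rho>" unfolding \<delta>_def using \<epsilon> \<rho> r by linarith+
    have "X \<in> closure S2" using two_sided X by blast
    then obtain y where y: "y \<in> S2" "dist y X < \<delta>/2"
      using \<delta>(1) by (meson closure_approachable half_gt_zero)
    have "closed \<Gamma>" using surface by (simp add: closed_C2_surface_def compact_imp_closed)
    then obtain X' where X': "X' \<in> \<Gamma>" and near: "\<And>Y'. Y' \<in> \<Gamma> \<Longrightarrow> dist y X' \<le> dist y Y'"
      using distance_attains_inf[of \<Gamma> y] X by blast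
    have "y \<notin> \<Gamma>" using y sides by blast
    then have "y \<noteq> X'" using X' by blast
    define d where "d = dist y X'"
    define \<nu>' where "\<nu>' = (1/d) *\<^sub>R (y - X')"
    have d: "0 < d" "d < \<delta>/2" using \<open>y \<noteq> X'\<close> near[OF X] y by (auto simp: d_def)
    have nrm': "unit_normal \<Gamma> X' \<nu>'"
      unfolding \<nu>'_def d_def by (rule unit_normal_towards_nearest[OF X' near \<open>y \<noteq> X'\<close>])
    have XX': "norm (X' - X) < \<delta>"
      using d y dist_triangle[of X' X y] by (simp add: d_def dist_norm norm_minus_commute)
    have yd: "y = X' + d *\<^sub>R \<nu>'" using d by (simp add: \<nu>'_def)
    have "y - (X' + r *\<^sub>R \<nu>') = (d - r) *\<^sub>R \<nu>'" by (simp add: yd scaleR_diff_left)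
    then have "dist (X' + r *\<^sub>R \<nu>') y < r"
      using nrm' d \<delta> by (simp add: dist_commute dist_norm unit_normal_def)
    then have yB: "y \<in> ball (X' + r *\<^sub>R \<nu>') r" by simp
    have av': "ball (X' + r *\<^sub>R \<nu>') r \<inter> \<Gamma> = {}"
      by (rule tangent_ball_avoids_surface[OF surface(1) reach_radius(2) X' nrm' r])
    have B': "ball (X' + r *\<^sub>R \<nu>') r \<inter> S1 = {}"
    proof (rule ccontr)
      assume "ball (X' + r *\<^sub>R \<nu>') r \<inter> S1 \<noteq> {}"
      then obtain V' where "V' \<in> ball (X' + r *\<^sub>R \<nu>') r" "V' \<in> closure S1"
        using closure_subset by blast
      from convex_part_on_one_side(1)[OF open_ball convex_ball av' this] yB y sides
      show False by blast
    qed
    \<comment> \<open>of the two balls at \<open>X\<close>, the one on the side towards which \<open>\<nu>'\<close> points\<close>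
    obtain w where w: "w = \<nu> \<or> w = - \<nu>" "w \<bullet> \<nu>' \<ge> 0"
    proof (cases "\<nu> \<bullet> \<nu>' \<ge> 0")
      case True then show ?thesis using that by blast
    next
      case False then show ?thesis using that[of "-\<nu>"] by simp
    qed
    have nw: "norm w = 1" "norm \<nu>' = 1"
      using w nrm nrm' by (auto simp: unit_normal_def)
    have est: "norm (s *\<^sub>R a + (s - r) *\<^sub>R b) \<le> \<rho>"
      if "norm a = 1" "norm b = 1" "a \<bullet> b \<ge> 0" for a b :: "real^3"
    proof -
      have "(norm (s *\<^sub>R a + (s - r) *\<^sub>R b))\<^sup>2 = s\<^sup>2 + (r - s)\<^sup>2 + 2 * (s * (s - r)) * (a \<bullet> b)"
      proof -
        have 1: "a \<bullet> a = 1" "b \<bullet> b = 1" using that by (simp_all add: norm_eq_1)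
        show ?thesis
          unfolding power2_norm_eq_inner inner_add_left inner_add_right inner_scaleR_left
            inner_scaleR_right 1 inner_commute[of b a]
          by (simp add: power2_eq_square algebra_simps)
      qed
      moreover have "s * (s - r) * (a \<bullet> b) \<le> 0"
        using s that by (simp add: mult_nonneg_nonpos mult_nonpos_nonneg)
      ultimately show ?thesis unfolding \<rho>_def
        by (intro real_le_rsqrt) linarith
    qed
    define q where "q = X' + s *\<^sub>R w + s *\<^sub>R \<nu>'"
    have "norm (q - (X' + r *\<^sub>R \<nu>')) \<le> \<rho>"
      using est[of w \<nu>'] nw w(2) by (simp add: q_def algebra_simps)
    then have q1: "q \<in> ball (X' + r *\<^sub>R \<nu>') r" using \<rho> by (simp add: dist_norm norm_minus_commute)
    have "norm (q - (X + r *\<^sub>R w)) \<le> norm (X' - X) + norm (s *\<^sub>R \<nu>' + (s - r) *\<^sub>R w)"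
      using norm_triangle_ineq[of "X' - X" "s *\<^sub>R \<nu>' + (s - r) *\<^sub>R w"] by (simp add: q_def algebra_simps)
    also have "\<dots> < r"
      using est[of \<nu>' w] nw w(2) XX' \<delta>(4) by (simp add: inner_commute)
    finally have q2: "q \<in> ball (X + r *\<^sub>R w) r" by (simp add: dist_norm norm_minus_commute)
    have "norm (q - X) \<le> norm (X' - X) + norm (s *\<^sub>R w + s *\<^sub>R \<nu>')"
      using norm_triangle_ineq[of "X' - X" "s *\<^sub>R w + s *\<^sub>R \<nu>'"] by (simp add: q_def algebra_simps)
    also have "norm (s *\<^sub>R w + s *\<^sub>R \<nu>') \<le> s + s"
      using norm_triangle_ineq[of "s *\<^sub>R w" "s *\<^sub>R \<nu>'"] nw s by simp
    finally have "norm (q - X) < \<epsilon>" using XX' \<delta>(2) s by linarith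
    then have "q \<in> \<Omega>" using \<epsilon> by (auto simp: dist_norm norm_minus_commute)
    then have "q \<in> S1" using q2 w(1) B1 B2 by auto
    then show False using q1 B' by blast
  qed
  then show ?thesis using av by blast
qed

text \<open>The vertex \<open>V\<close> is on the side of \<open>S1\<close>, and along each edge at \<open>V\<close> there is a point at least half an edge away
  that is not on the side of \<open>S2\<close>. Suppose \<open>V\<close> is close to its nearest point \<open>X\<close> of \<open>\<Gamma>\<close>, and let \<open>\<nu>\<close> be the normal at
  \<open>X\<close> towards \<open>V\<close>. No inward edge direction can have a markedly negative component along \<open>\<nu>\<close>, for
  then its point would lie inside the tangent ball in \<open>S2\<close>. Since \<open>\<nu>\<close> is a unit vector, some inward
  direction has component at least \<open>1/2\<close>, and the tangent ball in \<open>S1\<close>, which almost touches \<open>V\<close>,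
  contains a cube around a point of that edge.\<close>

lemma corner_contains_cube:
  assumes cell: "cell T \<subseteq> closure \<Omega>" and V: "V \<in> vertices T" "V \<in> closure S1 - \<Gamma>"
    and ne: "\<Gamma> \<noteq> {}" and m: "0 < m" "\<And>i. m \<le> side_length T i" "\<And>i. 5 * side_length T i \<le> r"
    and nb: "\<And>i. \<exists>t. V + t *\<^sub>R axis i 1 \<in> cell T \<inter> (closure S1 \<union> \<Gamma>) \<and> side_length T i / 2 \<le> \<bar>t\<bar>"
  shows "\<exists>u. cbox u (u + vec (m/800)) \<subseteq> subelement \<Gamma> S1 T"
proof -
  have r: "r > 0" by (rule reach_radius)
  \<comment> \<open>signs of the inward edge directions at \<open>V\<close>, and \<open>\<alpha>\<close> below is the inward offset of a cube\<close>
  define \<eta> :: "3 \<Rightarrow> real" where "\<eta> i = (if V $ i = fst T $ i then 1 else - 1)" for i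
  have \<eta>: "\<eta> i * \<eta> i = 1" "\<bar>\<eta> i\<bar> = 1" for i by (auto simp: \<eta>_def)
  define w where "w = m / 800"
  have w: "w > 0" using m by (simp add: w_def)
  have Vi: "(\<eta> i = 1 \<and> V $ i = fst T $ i) \<or> (\<eta> i = -1 \<and> V $ i = snd T $ i)" for i
    using V(1) by (auto simp: vertices_def \<eta>_def)
  have side: "snd T $ i = fst T $ i + side_length T i" for i by (simp add: side_length_def)
  have cube: "\<exists>u. \<forall>x\<in>cbox u (u + vec w). x \<in> cell T \<and>
      (\<forall>i. \<alpha> i \<le> \<eta> i * (x $ i - V $ i) \<and> \<eta> i * (x $ i - V $ i) \<le> \<alpha> i + w)"
    if \<alpha>: "\<And>i. 0 \<le> \<alpha> i" "\<And>i. \<alpha> i + w \<le> side_length T i" for \<alpha> :: "3 \<Rightarrow> real"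
  proof (intro exI ballI)
    define u :: "real^3" where "u = (\<chi> i. if \<eta> i = 1 then V $ i + \<alpha> i else V $ i - \<alpha> i - w)"
    fix x assume x: "x \<in> cbox u (u + vec w)"
    have *: "fst T $ i \<le> x $ i \<and> x $ i \<le> snd T $ i \<and>
        \<alpha> i \<le> \<eta> i * (x $ i - V $ i) \<and> \<eta> i * (x $ i - V $ i) \<le> \<alpha> i + w" for i
    proof -
      have "u $ i \<le> x $ i" "x $ i \<le> u $ i + w" using x by (auto simp: mem_box_cart)
      then show ?thesis using Vi[of i] \<alpha>[of i] side[of i] w by (auto simp: u_def)
    qed
    then show "x \<in> cell T \<and>
        (\<forall>i. \<alpha> i \<le> \<eta> i * (x $ i - V $ i) \<and> \<eta> i * (x $ i - V $ i) \<le> \<alpha> i + w)"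
      by (auto simp: cell_def mem_box_cart)
  qed
  have "closed \<Gamma>" using surface by (simp add: closed_C2_surface_def compact_imp_closed)
  then obtain X where X: "X \<in> \<Gamma>" and near: "\<And>Y. Y \<in> \<Gamma> \<Longrightarrow> dist V X \<le> dist V Y"
    using distance_attains_inf[of \<Gamma> V] ne by blast
  define d where "d = dist V X"
  have d: "d > 0" using V X by (auto simp: d_def)
  show ?thesis
  proof (cases "m / 200 \<le> d")
    case True
    \<comment> \<open>\<open>V\<close> is far from \<open>\<Gamma>\<close>: the cube sits in the corner at \<open>V\<close>\<close>
    have "0 + w \<le> side_length T i" for i using m(1) m(2)[of i] by (simp add: w_def)
    from cube[OF order_refl this] obtain u where u: "\<And>x. x \<in> cbox u (u + vec w) \<Longrightarrow> x \<in> cell T \<and>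
      (\<forall>i. 0 \<le> \<eta> i * (x $ i - V $ i) \<and> \<eta> i * (x $ i - V $ i) \<le> 0 + w)"
      by blast
    have av: "ball V d \<inter> \<Gamma> = {}" using near by (force simp: d_def)
    have sub: "ball V d \<inter> closure \<Omega> \<subseteq> closure S1 - \<Gamma>"
      by (rule convex_part_on_one_side(2)[OF open_ball convex_ball av]) (use V d in auto)
    have "x \<in> subelement \<Gamma> S1 T" if x: "x \<in> cbox u (u + vec w)" for x
    proof -
      have "\<bar>(x - V) $ i\<bar> \<le> w" for i
      proof -
        have "\<bar>\<eta> i * (x $ i - V $ i)\<bar> \<le> w" using u[OF x] by auto
        then show ?thesis by (simp add: abs_mult \<eta>)
      qed
      from this[of 1] this[of 2] this[of 3] have "norm (x - V) \<le> 3 * w"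
        using norm_le_l1_cart[of "x - V"] unfolding sum_3 by linarith
      then have "x \<in> ball V d"
        using True m by (simp add: dist_norm norm_minus_commute w_def)
      then show ?thesis using sub u[OF x] cell by (auto simp: subelement_def side_def)
    qed
    then show ?thesis unfolding w_def by blast
  next
    case False
    define \<nu> where "\<nu> = (1 / d) *\<^sub>R (V - X)"
    have "V \<noteq> X" using V X by auto
    have nrm: "unit_normal \<Gamma> X \<nu>"
      unfolding \<nu>_def d_def by (rule unit_normal_towards_nearest[OF X near \<open>V \<noteq> X\<close>])
    then have n1: "norm \<nu> = 1" by (simp add: unit_normal_def)
    have VX: "V = X + d *\<^sub>R \<nu>" using d by (simp add: \<nu>_def)
    have mr: "5 * m \<le> r" using m(2)[of 1] m(3)[of 1] by linarith
    have av1: "ball (X + r *\<^sub>R \<nu>) r \<inter> \<Gamma> = {}"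
      by (rule tangent_ball_avoids_surface[OF surface(1) reach_radius(2) X nrm r])
    have "V - (X + r *\<^sub>R \<nu>) = (d - r) *\<^sub>R \<nu>" by (simp add: VX scaleR_diff_left)
    then have "V \<in> ball (X + r *\<^sub>R \<nu>) r"
      using n1 d False mr m r by (simp add: dist_commute dist_norm)
    note B1 = convex_part_on_one_side[OF open_ball convex_ball av1 this]
    have B2: "ball (X - r *\<^sub>R \<nu>) r \<inter> (closure S1 \<union> \<Gamma>) = {}"
      using opposite_tangent_ball[OF X nrm B1(1)] V by blast
    define \<nu>' where "\<nu>' i = \<eta> i * \<nu> $ i" for i
    \<comment> \<open>the tangent ball in \<open>S2\<close> excludes the point on the edge, which gives \<open>main\<close>; there
      \<open>s \<le> r/5\<close> costs \<open>1/10\<close>, \<open>d \<le> s/100\<close> costs \<open>1/100\<close>, and \<open>3/25\<close> exceeds the sum\<close>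
    have lower: "- (3/25) \<le> \<nu>' i" for i
    proof -
      obtain t where t: "V + t *\<^sub>R axis i 1 \<in> cell T" "V + t *\<^sub>R axis i 1 \<in> closure S1 \<union> \<Gamma>"
        "side_length T i / 2 \<le> \<bar>t\<bar>" using nb[of i] by auto
      define s where "s = \<bar>t\<bar>"
      have "fst T $ i \<le> V $ i + t" "V $ i + t \<le> snd T $ i"
        using t(1) by (auto simp: cell_def mem_box_cart axis_def dest!: spec[of _ i])
      then have s: "t = \<eta> i * s" "s \<le> side_length T i"
        using Vi[of i] side[of i] m(1) m(2)[of i] by (auto simp: s_def)
      have s1: "m / 2 \<le> s" "5 * s \<le> r" using t(3) m(2)[of i] m(3)[of i] s(2) by (auto simp: s_def)
      have "V + t *\<^sub>R axis i 1 \<notin> ball (X - r *\<^sub>R \<nu>) r" using B2 t(2) by blast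
      then have "r \<le> norm ((V + t *\<^sub>R axis i 1) - (X - r *\<^sub>R \<nu>))"
        by (simp add: dist_norm norm_minus_commute not_less)
      also have "(V + t *\<^sub>R axis i 1) - (X - r *\<^sub>R \<nu>) = (d + r) *\<^sub>R \<nu> + t *\<^sub>R axis i 1"
        by (simp add: VX algebra_simps)
      finally have "r \<le> norm ((d + r) *\<^sub>R \<nu> + t *\<^sub>R axis i 1)" .
      then have "r\<^sup>2 \<le> (norm ((d + r) *\<^sub>R \<nu> + t *\<^sub>R axis i 1))\<^sup>2" using r by simp
      also have "\<dots> = (d + r)\<^sup>2 + 2 * (d + r) * s * \<nu>' i + s\<^sup>2"
      proof -
        have 1: "\<nu> \<bullet> \<nu> = 1" using n1 by (simp add: norm_eq_1)
        show ?thesis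
          unfolding power2_norm_eq_inner inner_add_left inner_add_right inner_scaleR_left
            inner_scaleR_right 1 s(1) \<nu>'_def inner_axis_axis inner_axis inner_commute[of "axis i 1" \<nu>]
          by (simp add: \<eta> power2_eq_square algebra_simps)
      qed
      finally have main: "r\<^sup>2 \<le> (d + r)\<^sup>2 + 2 * (d + r) * s * \<nu>' i + s\<^sup>2" .
      show ?thesis
      proof (rule ccontr)
        assume "\<not> - (3/25) \<le> \<nu>' i"
        then have "(d + r) * s * \<nu>' i \<le> (d + r) * s * (- (3/25))"
          using d r s1 m by (intro mult_left_mono) auto
        then have 1: "(d + r) * s * \<nu>' i \<le> - (3/25) * (d * s) - (3/25) * (r * s)"
          by (simp only: algebra_simps)
        have 2: "5 * (s * s) \<le> r * s"
          using mult_right_mono[OF s1(2), of s] s1 m by simp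
        have "d * (r + d) \<le> (s / 100) * (r + d)"
          using False s1 d r by (intro mult_right_mono) auto
        then have 3: "d * r + d * d \<le> (1/100) * (r * s) + (1/100) * (d * s)"
          by (simp add: algebra_simps)
        have 4: "0 < d * s" "0 < r * s" "0 < d * d" using d s1 m r by auto
        have "(d + r)\<^sup>2 = d * d + 2 * (d * r) + r\<^sup>2"
          by (simp add: power2_eq_square algebra_simps)
        moreover have "2 * (d + r) * s * \<nu>' i = 2 * ((d + r) * s * \<nu>' i)"
          by (simp only: mult.assoc)
        moreover have "s\<^sup>2 = s * s" by (rule power2_eq_square)
        ultimately show False using main 1 2 3 4 by linarith
      qed
    qed
    have "\<exists>i. 1/2 \<le> \<nu>' i"
    proof (rule ccontr)
      assume "\<not> ?thesis"
      then have sq: "(\<nu>' i)\<^sup>2 \<le> 1/4" for i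
        using lower[of i] abs_le_square_iff[of "\<nu>' i" "1/2"]
        by (auto simp: not_le power2_eq_square abs_le_iff dest!: spec[of _ i])
      have "(\<nu>' i)\<^sup>2 = (\<nu> $ i)\<^sup>2" for i
        using \<eta>(1)[of i] by (simp add: \<nu>'_def power_mult_distrib power2_eq_square[of "\<eta> i"])
      moreover have "(\<nu> $ 1)\<^sup>2 + (\<nu> $ 2)\<^sup>2 + (\<nu> $ 3)\<^sup>2 = 1"
        using n1 by (simp add: norm_eq_1 inner_vec_def sum_3 power2_eq_square)
      ultimately show False using sq[of 1] sq[of 2] sq[of 3] by simp
    qed
    then obtain k where k: "1/2 \<le> \<nu>' k" ..
    \<comment> \<open>the cube is pushed by \<open>m/2\<close> along the edge that points into the ball in \<open>S1\<close>\<close>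
    define \<alpha> where "\<alpha> i = (if i = k then m / 2 else 0)" for i
    have \<alpha>: "0 \<le> \<alpha> i" "\<alpha> i + w \<le> side_length T i" for i
      using m(1) m(2)[of i] by (auto simp: \<alpha>_def w_def)
    obtain u where u: "\<And>x. x \<in> cbox u (u + vec w) \<Longrightarrow> x \<in> cell T \<and>
      (\<forall>i. \<alpha> i \<le> \<eta> i * (x $ i - V $ i) \<and> \<eta> i * (x $ i - V $ i) \<le> \<alpha> i + w)"
      using cube[OF \<alpha>] by blast
    have "x \<in> subelement \<Gamma> S1 T" if x: "x \<in> cbox u (u + vec w)" for x
    proof -
      define y where "y i = \<eta> i * (x $ i - V $ i)" for i
      have y: "\<alpha> i \<le> y i" "y i \<le> \<alpha> i + w" for i using u[OF x] by (auto simp: y_def)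
      have z: "(x - V) $ i = \<eta> i * y i" for i
      proof -
        have "\<eta> i * y i = (\<eta> i * \<eta> i) * (x $ i - V $ i)" by (simp only: y_def mult.assoc)
        then show ?thesis by (simp add: \<eta>)
      qed
      have sum\<alpha>: "\<alpha> 1 + \<alpha> 2 + \<alpha> 3 = m / 2"
        using exhaust_3[of k] by (auto simp: \<alpha>_def)
      have "\<bar>(x - V) $ i\<bar> \<le> \<alpha> i + w" for i
        unfolding z abs_mult \<eta> using y[of i] \<alpha>[of i] by simp
      from this[of 1] this[of 2] this[of 3] have "norm (x - V) \<le> m / 2 + 3 * w"
        using norm_le_l1_cart[of "x - V"] sum\<alpha> unfolding sum_3 by linarith
      then have "norm (x - V) \<le> (3/5) * m" using m by (simp add: w_def)
      then have nz: "(norm (x - V))\<^sup>2 \<le> (9/25) * m\<^sup>2"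
        using power_mono[of "norm (x - V)" "(3/5) * m" 2] by (simp add: power2_eq_square)
      have summand: "y i * \<nu>' i \<ge> \<alpha> i / 2 - (3/25) * w" for i
      proof (cases "i = k")
        case True
        have "y i * \<nu>' i \<ge> \<alpha> i * (1/2)"
          using y[of i] \<alpha>[of i] k True by (intro mult_mono) auto
        then show ?thesis using w by simp
      next
        case False
        have y0: "0 \<le> y i" "y i \<le> w" using y[of i] False by (auto simp: \<alpha>_def)
        have "y i * \<nu>' i \<ge> y i * (- (3/25))" using lower[of i] y0 by (intro mult_left_mono) auto
        then show ?thesis using y0 False by (simp add: \<alpha>_def)
      qed
      have "(x - V) \<bullet> \<nu> = y 1 * \<nu>' 1 + y 2 * \<nu>' 2 + y 3 * \<nu>' 3"
        unfolding inner_vec_def sum_3 z \<nu>'_def by (simp add: algebra_simps)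
      then have "(x - V) \<bullet> \<nu> \<ge> m / 4 - (9/25) * w"
        using summand[of 1] summand[of 2] summand[of 3] sum\<alpha> by linarith
      then have zn: "(x - V) \<bullet> \<nu> \<ge> (1/5) * m" using m by (simp add: w_def)
      have rd: "4 * m \<le> r - d" using mr False m by simp
      have "(r - d) * ((x - V) \<bullet> \<nu>) \<ge> (4 * m) * ((1/5) * m)"
        using rd zn m by (intro mult_mono) auto
      moreover have "(norm ((x - V) - (r - d) *\<^sub>R \<nu>))\<^sup>2
          = (norm (x - V))\<^sup>2 - 2 * ((r - d) * ((x - V) \<bullet> \<nu>)) + (r - d)\<^sup>2"
      proof -
        have 1: "\<nu> \<bullet> \<nu> = 1" using n1 by (simp add: norm_eq_1)
        show ?thesis
          unfolding power2_norm_eq_inner inner_diff_left[of _ "(r - d) *\<^sub>R \<nu>"] inner_diff_right[of _ _ "(r - d) *\<^sub>R \<nu>"]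
            inner_scaleR_left inner_scaleR_right 1 inner_commute[of \<nu> "x - V"]
          by (simp only: power2_eq_square algebra_simps)
      qed
      moreover have "(r - d)\<^sup>2 \<le> r\<^sup>2"
        using rd m d by (intro power_mono) auto
      moreover have "m\<^sup>2 > 0" using m by simp
      ultimately have "(norm ((x - V) - (r - d) *\<^sub>R \<nu>))\<^sup>2 < r\<^sup>2"
        using nz by (simp add: power2_eq_square)
      then have "norm ((x - V) - (r - d) *\<^sub>R \<nu>) < r"
        using r power_less_imp_less_base by fastforce
      also have "(x - V) - (r - d) *\<^sub>R \<nu> = x - (X + r *\<^sub>R \<nu>)"
        by (simp add: VX algebra_simps)
      finally have "x \<in> ball (X + r *\<^sub>R \<nu>) r"
        by (simp add: dist_norm norm_minus_commute)
      then show ?thesis using B1(2) V u[OF x] cell by (auto simp: subelement_def side_def)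
    qed
    then show ?thesis unfolding w_def by blast
  qed
qed

end

section \<open>Inverse estimates for trilinear functions\<close>

lemma Q1_E:
  assumes "p \<in> Q1"
  obtains c :: "nat \<Rightarrow> real" where "p = (\<lambda>X. c 0 + c 1 * X$1 + c 2 * X$2 + c 3 * X$3 + c 4 * (X$1 * X$2)
     + c 5 * (X$1 * X$3) + c 6 * (X$2 * X$3) + c 7 * (X$1 * X$2 * X$3))"
  using assms by (auto simp: Q1_def)

lemma Q1_continuous: "p \<in> Q1 \<Longrightarrow> continuous_on A p"
  by (erule Q1_E) (auto intro!: continuous_intros)

lemma grad_unique:
  assumes "(p has_derivative (\<lambda>v. g \<bullet> v)) (at X)"
  shows "grad p X = g"
  unfolding grad_def frechet_derivative_at[OF assms, symmetric]
  by (simp add: inner_axis vec_eq_iff)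

lemma trilinear_has_derivative:
  fixes c :: "nat \<Rightarrow> real" and X :: "real^3"
  shows "((\<lambda>X. c 0 + c 1 * X$1 + c 2 * X$2 + c 3 * X$3 + c 4 * (X$1 * X$2)
       + c 5 * (X$1 * X$3) + c 6 * (X$2 * X$3) + c 7 * (X$1 * X$2 * X$3)) has_derivative
     (\<lambda>v. vector [c 1 + c 4 * X$2 + c 5 * X$3 + c 7 * (X$2 * X$3),
       c 2 + c 4 * X$1 + c 6 * X$3 + c 7 * (X$1 * X$3),
       c 3 + c 5 * X$1 + c 6 * X$2 + c 7 * (X$1 * X$2)] \<bullet> v)) (at X)"
proof -
  have [derivative_intros]: "((\<lambda>X::real^3. X $ i) has_derivative (\<lambda>v. v $ i)) (at X)" for i
    by (rule bounded_linear.has_derivative[OF bounded_linear_vec_nth has_derivative_ident])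
  show ?thesis
    by (auto intro!: derivative_eq_intros simp: inner_vec_def sum_3 fun_eq_iff algebra_simps)
qed

lemma Q1_has_grad:
  assumes "p \<in> Q1"
  shows "(p has_derivative (\<lambda>v. grad p X \<bullet> v)) (at X)"
proof -
  obtain c :: "nat \<Rightarrow> real" where p: "p = (\<lambda>X. c 0 + c 1 * X$1 + c 2 * X$2 + c 3 * X$3 + c 4 * (X$1 * X$2)
     + c 5 * (X$1 * X$3) + c 6 * (X$2 * X$3) + c 7 * (X$1 * X$2 * X$3))"
    using assms by (rule Q1_E)
  note g = trilinear_has_derivative[of c X, folded p]
  show ?thesis using g by (simp add: grad_unique[OF g])
qed

text \<open>Partial derivatives stay in \<open>Q1\<close>, and difference quotients along an axis are exact, since the
  functions are affine in each variable. The second fact later turns bounds on values into bounds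
  on derivatives.\<close>

lemma Q1_partial:
  assumes "p \<in> Q1"
  shows "(\<lambda>X. grad p X $ i) \<in> Q1" and "p (X + s *\<^sub>R axis i 1) = p X + s * grad p X $ i"
proof -
  obtain c :: "nat \<Rightarrow> real" where p: "p = (\<lambda>X. c 0 + c 1 * X$1 + c 2 * X$2 + c 3 * X$3 + c 4 * (X$1 * X$2)
     + c 5 * (X$1 * X$3) + c 6 * (X$2 * X$3) + c 7 * (X$1 * X$2 * X$3))"
    using assms by (rule Q1_E)
  have g: "grad p X = vector [c 1 + c 4 * X$2 + c 5 * X$3 + c 7 * (X$2 * X$3),
     c 2 + c 4 * X$1 + c 6 * X$3 + c 7 * (X$1 * X$3), c 3 + c 5 * X$1 + c 6 * X$2 + c 7 * (X$1 * X$2)]" for X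
    unfolding p by (rule grad_unique[OF trilinear_has_derivative])
  show "p (X + s *\<^sub>R axis i 1) = p X + s * grad p X $ i"
    unfolding g using exhaust_3[of i] by (auto simp: p axis_def algebra_simps)
  have "(\<lambda>X. grad p X $ 1) \<in> Q1" unfolding g Q1_def mem_Collect_eq
    by (rule exI[of _ "(\<lambda>_. 0)(0 := c 1, 2 := c 4, 3 := c 5, 6 := c 7)"]) (simp add: fun_eq_iff)
  moreover have "(\<lambda>X. grad p X $ 2) \<in> Q1" unfolding g Q1_def mem_Collect_eq
    by (rule exI[of _ "(\<lambda>_. 0)(0 := c 2, 1 := c 4, 3 := c 6, 5 := c 7)"]) (simp add: fun_eq_iff)
  moreover have "(\<lambda>X. grad p X $ 3) \<in> Q1" unfolding g Q1_def mem_Collect_eq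
    by (rule exI[of _ "(\<lambda>_. 0)(0 := c 3, 1 := c 5, 2 := c 6, 4 := c 7)"]) (simp add: fun_eq_iff)
  ultimately show "(\<lambda>X. grad p X $ i) \<in> Q1" using exhaust_3[of i] by metis
qed

text \<open>The values at \<open>t\<close> and \<open>t + h\<close> determine an affine function; the coefficients of the extrapolation
  to \<open>y\<close> are \<open>1 - e\<close> and \<open>e\<close> with \<open>e = (y - t) / h\<close>.\<close>

lemma affine_extrapolation:
  fixes a b :: real
  assumes "h > 0" "\<bar>y - t\<bar> \<le> B * h"
  shows "(a + b * y)\<^sup>2 \<le> 2 * (1 + B)\<^sup>2 * ((a + b * t)\<^sup>2 + (a + b * (t + h))\<^sup>2)"
proof -
  define e where "e = (y - t) / h"
  have e: "\<bar>e\<bar> \<le> B" using assms by (simp add: e_def abs_divide divide_le_eq)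
  have "y = t + e * h" using assms by (simp add: e_def)
  then have eq: "a + b * y = (1 - e) * (a + b * t) + e * (a + b * (t + h))"
    by (simp add: algebra_simps)
  have "(u + v)\<^sup>2 \<le> 2 * u\<^sup>2 + 2 * v\<^sup>2" for u v :: real
    using zero_le_power2[of "u - v"] by (simp add: power2_eq_square algebra_simps)
  then have "(a + b * y)\<^sup>2 \<le> 2 * ((1 - e)\<^sup>2 * (a + b * t)\<^sup>2) + 2 * (e\<^sup>2 * (a + b * (t + h))\<^sup>2)"
    unfolding eq by (metis power_mult_distrib)
  also have "\<dots> \<le> 2 * ((1 + B)\<^sup>2 * (a + b * t)\<^sup>2) + 2 * ((1 + B)\<^sup>2 * (a + b * (t + h))\<^sup>2)"
  proof -
    have "(1 - e)\<^sup>2 \<le> (1 + B)\<^sup>2" "e\<^sup>2 \<le> (1 + B)\<^sup>2"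
      using e by (auto intro!: power2_le_iff_abs_le[THEN iffD2])
    then show ?thesis by (intro add_mono mult_left_mono mult_right_mono) auto
  qed
  finally show ?thesis by (simp add: algebra_simps)
qed

text \<open>One-dimensional extrapolation in the three variables in turn. The eight sample points are the
  corners of a cube based at \<open>X\<close>, so the inequality can be integrated over \<open>X\<close>.\<close>

lemma Q1_extrapolation:
  fixes X Y :: "real^3"
  assumes p: "p \<in> Q1" and h: "h > 0" and near: "\<And>i. \<bar>Y $ i - X $ i\<bar> \<le> B * h"
  shows "(p Y)\<^sup>2 \<le> (2 * (1 + B)\<^sup>2) ^ 3 *
           (\<Sum>a\<in>{0,h}. \<Sum>b\<in>{0,h}. \<Sum>c\<in>{0,h}. (p (vector [a,b,c] + X))\<^sup>2)"
proof -
  define K where "K = 2 * (1 + B)\<^sup>2"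
  have K: "K \<ge> 0" by (simp add: K_def)
  define P where "P a b c = (p (vector [a,b,c]))\<^sup>2" for a b c
  obtain k :: "nat \<Rightarrow> real" where pk: "p = (\<lambda>X. k 0 + k 1 * X$1 + k 2 * X$2 + k 3 * X$3 + k 4 * (X$1 * X$2)
     + k 5 * (X$1 * X$3) + k 6 * (X$2 * X$3) + k 7 * (X$1 * X$2 * X$3))"
    using p by (rule Q1_E)
  have 1: "P (Y$1) b c \<le> K * (\<Sum>s\<in>{0,h}. P (s + X$1) b c)" for b c
    using affine_extrapolation[OF h near[of 1], of "k 0 + k 2 * b + k 3 * c + k 6 * (b * c)"
        "k 1 + k 4 * b + k 5 * c + k 7 * (b * c)"] h
    by (simp add: P_def pk K_def algebra_simps)
  have 2: "P a (Y$2) c \<le> K * (\<Sum>s\<in>{0,h}. P a (s + X$2) c)" for a c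
    using affine_extrapolation[OF h near[of 2], of "k 0 + k 1 * a + k 3 * c + k 5 * (a * c)"
        "k 2 + k 4 * a + k 6 * c + k 7 * (a * c)"] h
    by (simp add: P_def pk K_def algebra_simps)
  have 3: "P a b (Y$3) \<le> K * (\<Sum>s\<in>{0,h}. P a b (s + X$3))" for a b
    using affine_extrapolation[OF h near[of 3], of "k 0 + k 1 * a + k 2 * b + k 4 * (a * b)"
        "k 3 + k 5 * a + k 6 * b + k 7 * (a * b)"] h
    by (simp add: P_def pk K_def algebra_simps)
  have "(p Y)\<^sup>2 = P (Y$1) (Y$2) (Y$3)" by (simp add: P_def pk)
  also have "\<dots> \<le> K * (\<Sum>a\<in>{0,h}. P (a + X$1) (Y$2) (Y$3))" by (rule 1)
  also have "\<dots> \<le> K * (\<Sum>a\<in>{0,h}. K * (\<Sum>b\<in>{0,h}. P (a + X$1) (b + X$2) (Y$3)))"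
    by (intro mult_left_mono sum_mono 2 K)
  also have "\<dots> \<le> K * (\<Sum>a\<in>{0,h}. K * (\<Sum>b\<in>{0,h}. K * (\<Sum>c\<in>{0,h}. P (a + X$1) (b + X$2) (c + X$3))))"
    by (intro mult_left_mono sum_mono 3 K)
  also have "\<dots> = K ^ 3 * (\<Sum>a\<in>{0,h}. \<Sum>b\<in>{0,h}. \<Sum>c\<in>{0,h}. P (a + X$1) (b + X$2) (c + X$3))"
    by (simp add: power3_eq_cube sum_distrib_left mult.assoc)
  also have "(\<lambda>a b c. P (a + X$1) (b + X$2) (c + X$3)) = (\<lambda>a b c. (p (vector [a,b,c] + X))\<^sup>2)"
    by (simp add: P_def pk fun_eq_iff)
  finally show ?thesis unfolding K_def .
qed

lemma set_integral_translated_le: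
  fixes f :: "'a::euclidean_space \<Rightarrow> real"
  assumes f: "continuous_on UNIV f" "\<And>x. 0 \<le> f x" and A: "A \<in> sets borel"
    and Q: "compact Q" "(+) v ` A \<subseteq> Q"
  shows "set_integrable lborel A (\<lambda>x. f (v + x))"
    and "(LINT x:A|lborel. f (v + x)) \<le> (LINT x:Q|lborel. f x)"
proof -
  have fm: "f \<in> borel_measurable borel" using f(1) by (rule borel_measurable_continuous_onI)
  have intQ: "integrable lborel (\<lambda>x. indicat_real Q x *\<^sub>R f x)"
    using continuous_on_subset[OF f(1)] by (intro borel_integrable_compact[OF Q(1)]) auto
  have A': "A \<in> sets lborel" using A by simp
  define F where "F x = indicat_real A (x - v) *\<^sub>R f x" for x
  have Fm: "F \<in> borel_measurable borel" unfolding F_def using fm A by measurable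
  have le: "F x \<le> indicat_real Q x *\<^sub>R f x" for x
  proof (cases "x - v \<in> A")
    case True
    then have "v + (x - v) \<in> Q" using Q(2) by blast
    then show ?thesis using True f(2)[of x] by (simp add: F_def)
  qed (use f(2)[of x] in \<open>simp add: F_def\<close>)
  have intF: "integrable lborel F"
  proof (rule Bochner_Integration.integrable_bound[OF intQ])
    show "F \<in> borel_measurable lborel" using Fm by simp
    show "AE x in lborel. norm (F x) \<le> norm (indicat_real Q x *\<^sub>R f x)"
    proof (intro AE_I2)
      fix x
      have "0 \<le> F x" using f(2)[of x] by (simp add: F_def)
      then show "norm (F x) \<le> norm (indicat_real Q x *\<^sub>R f x)" using le[of x] by simp
    qed
  qed
  have plus: "(+) v \<in> measurable lborel borel" by simp
  have "integrable (distr lborel borel ((+) v)) F"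
    using intF by (simp add: lborel_distr_plus)
  then have "integrable lborel (\<lambda>x. F (v + x))"
    by (rule integrable_distr[OF plus])
  then show "set_integrable lborel A (\<lambda>x. f (v + x))"
    by (simp add: set_integrable_def F_def)
  have "(LINT x:A|lborel. f (v + x)) = (LINT x|lborel. F (v + x))"
    by (simp add: set_lebesgue_integral_def F_def)
  also have "\<dots> = (LINT x|distr lborel borel ((+) v). F x)"
    by (rule integral_distr[OF plus Fm, symmetric])
  also have "\<dots> = (LINT x|lborel. F x)" by (simp add: lborel_distr_plus)
  also have "\<dots> \<le> (LINT x:Q|lborel. f x)"
    unfolding set_lebesgue_integral_def by (intro integral_mono intF intQ le)
  finally show "(LINT x:A|lborel. f (v + x)) \<le> (LINT x:Q|lborel. f x)" .
qed

lemma set_integral_sum: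
  fixes f :: "'i \<Rightarrow> 'a \<Rightarrow> 'b::{banach, second_countable_topology}"
  assumes "\<And>i. i \<in> I \<Longrightarrow> set_integrable M A (f i)"
  shows "set_integrable M A (\<lambda>x. \<Sum>i\<in>I. f i x)"
    and "(LINT x:A|M. (\<Sum>i\<in>I. f i x)) = (\<Sum>i\<in>I. (LINT x:A|M. f i x))"
  using assms unfolding set_integrable_def set_lebesgue_integral_def scaleR_sum_right
  by (simp_all add: Bochner_Integration.integral_sum)

text \<open>Integrating the pointwise extrapolation over \<open>X\<close> in the subcube of half the size keeps all eight
  translates inside the cube. This is an inverse estimate with an explicit constant, valid also
  for \<open>Y\<close> outside the cube.\<close>

lemma Q1_value_le_L2_on_cube:
  fixes Y u :: "real^3"
  assumes p: "p \<in> Q1" and h: "h > 0" and near: "\<And>i. \<bar>Y $ i - u $ i\<bar> \<le> B * h"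
  shows "(p Y)\<^sup>2 * h ^ 3 \<le> 8 * (2 * (2 + B)\<^sup>2) ^ 3 * (LINT X:cbox u (u + vec (2 * h))|lborel. (p X)\<^sup>2)"
proof -
  define K where "K = (2 * (2 + B)\<^sup>2) ^ 3"
  define A where "A = cbox u (u + vec h)"
  define Q where "Q = cbox u (u + vec (2 * h))"
  define J where "J = {0, h}"
  have K: "K \<ge> 0" by (simp add: K_def)
  have cp: "continuous_on UNIV (\<lambda>X. (p X)\<^sup>2)"
    by (intro continuous_intros Q1_continuous[OF p])
  have sub: "(+) (vector [a,b,c]) ` A \<subseteq> Q" if "a \<in> J" "b \<in> J" "c \<in> J" for a b c
    using that h by (auto simp: A_def Q_def J_def mem_box_cart forall_3)
  note tr = set_integral_translated_le[OF cp zero_le_power2 _ _ sub]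
  have int: "set_integrable lborel A (\<lambda>X. (p (vector [a,b,c] + X))\<^sup>2)"
    and le: "(LINT X:A|lborel. (p (vector [a,b,c] + X))\<^sup>2) \<le> (LINT X:Q|lborel. (p X)\<^sup>2)"
    if "a \<in> J" "b \<in> J" "c \<in> J" for a b c
    using tr[OF _ _ that] by (auto simp: A_def Q_def)
  have pt: "(p Y)\<^sup>2 \<le> K * (\<Sum>a\<in>J. \<Sum>b\<in>J. \<Sum>c\<in>J. (p (vector [a,b,c] + X))\<^sup>2)" if X: "X \<in> A" for X
  proof -
    have "\<bar>Y $ i - X $ i\<bar> \<le> (1 + B) * h" for i
    proof -
      have "u $ i \<le> X $ i" "X $ i \<le> u $ i + h" using X by (auto simp: A_def mem_box_cart)
      then show ?thesis using near[of i] by (simp add: algebra_simps)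
    qed
    from Q1_extrapolation[OF p h this] show ?thesis by (simp add: K_def J_def add.assoc[symmetric])
  qed
  have "measure lborel A = h ^ 3"
    using h by (simp add: A_def content_cbox_if_cart interval_ne_empty_cart)
  then have "(p Y)\<^sup>2 * h ^ 3 = (LINT X:A|lborel. (p Y)\<^sup>2)"
    by (simp add: set_lebesgue_integral_def A_def mult.commute)
  also have "\<dots> \<le> (LINT X:A|lborel. K * (\<Sum>a\<in>J. \<Sum>b\<in>J. \<Sum>c\<in>J. (p (vector [a,b,c] + X))\<^sup>2))"
  proof (rule set_integral_mono)
    show "set_integrable lborel A (\<lambda>X. (p Y)\<^sup>2)"
      unfolding A_def set_integrable_def
      by (rule borel_integrable_compact[OF compact_cbox continuous_on_const])
    show "set_integrable lborel A (\<lambda>X. K * (\<Sum>a\<in>J. \<Sum>b\<in>J. \<Sum>c\<in>J. (p (vector [a,b,c] + X))\<^sup>2))"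
      using int by (intro set_integrable_mult_right set_integral_sum(1))
  qed (rule pt)
  also have "\<dots> = K * (\<Sum>a\<in>J. \<Sum>b\<in>J. \<Sum>c\<in>J. (LINT X:A|lborel. (p (vector [a,b,c] + X))\<^sup>2))"
    using int by (simp add: set_integral_sum)
  also have "\<dots> \<le> K * (\<Sum>a\<in>J. \<Sum>b\<in>J. \<Sum>c\<in>J. (LINT X:Q|lborel. (p X)\<^sup>2))"
    by (intro mult_left_mono sum_mono le K)
  also have "\<dots> = 8 * K * (LINT X:Q|lborel. (p X)\<^sup>2)"
    using h by (simp add: J_def)
  finally show ?thesis unfolding K_def Q_def .
qed

section \<open>Stability of the extension on a set containing a cube\<close>

text \<open>This is \<open>2 + 72 M^5 K\<close>, where \<open>K\<close> is the constant in \<open>p(Y)^2 m^3 \<le> K * (integral of p^2)\<close> for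
  cubes of side \<open>m/800\<close> and points \<open>Y\<close> each of whose coordinates is within \<open>2 M m\<close> of that of the
  lower corner.\<close>

definition stability_const :: "real \<Rightarrow> real" where
  "stability_const M = 2 + 72 * M ^ 5 * (8 * 1600 ^ 3 * (2 * (2 + 3200 * M)\<^sup>2) ^ 3)"

lemma square_sum_le: "(a + b)\<^sup>2 \<le> 2 * a\<^sup>2 + 2 * (b::real)\<^sup>2"
  using zero_le_power2[of "a - b"] by (simp add: power2_eq_square algebra_simps)

text \<open>The added term is a fixed multiple of \<open>grad p F \<bullet> n\<close>, times an affine function that has a unit
  gradient and is bounded on the cell by its diameter. The inverse estimate on
  the cube inside \<open>S\<close> controls that number: for \<open>j = 1\<close> it is applied to the partial derivatives of \<open>p\<close>, which are again in \<open>Q1\<close>; for \<open>j = 0\<close> it is applied to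
  \<open>p\<close> at \<open>F\<close> and at \<open>F\<close> shifted by \<open>m\<close> along an axis. The powers of \<open>m\<close> cancel, so only
  the bound \<open>M\<close> on the ratio of cell size to cube size remains.\<close>

lemma extension_stable:
  assumes p: "p \<in> Q1" and S: "S \<in> sets borel" "S \<subseteq> cell T"
    and cube: "cbox u (u + vec (m/800)) \<subseteq> S"
    and m: "0 < m" "1 \<le> M" "\<And>i. side_length T i \<le> M * m" and F: "F \<in> cell T"
    and n: "norm n = 1" and s: "\<bar>k\<bar> \<le> s" "1 \<le> s" and j: "j \<in> {0, 1}"
  shows "H_seminorm j S (\<lambda>X. p X + k * (grad p F \<bullet> n) * ((X - F) \<bullet> n))
    \<le> sqrt (stability_const M) * s * H_seminorm j S p"
proof -
  define K where "K = 8 * 1600 ^ 3 * (2 * (2 + 3200 * M)\<^sup>2) ^ 3"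
  have K: "0 \<le> K" by (simp add: K_def)
  have sc: "stability_const M = 2 + 72 * M ^ 5 * K" by (simp add: stability_const_def K_def)
  define D where "D = grad p F \<bullet> n"
  have int: "set_integrable lborel S f" if "continuous_on UNIV f" for f :: "real^3 \<Rightarrow> real"
  proof -
    have "continuous_on (cell T) f" using that continuous_on_subset by blast
    then have "set_integrable lborel (cell T) f"
      unfolding set_integrable_def cell_def by (intro borel_integrable_compact compact_cbox)
    then show ?thesis by (rule set_integrable_subset) (use S in auto)
  qed
  have vol: "(LINT X:S|lborel. c) \<le> c * (M * m) ^ 3" if "0 \<le> c" for c :: real
  proof -
    have "measure lborel S \<le> measure lborel (cell T)"
      using S by (intro measure_mono_fmeasurable) (auto simp: cell_def)
    also have "\<dots> = (\<Prod>i\<in>UNIV. side_length T i)"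
      using F by (auto simp: cell_def content_cbox_if_cart side_length_def)
    also have "\<dots> \<le> (\<Prod>i\<in>(UNIV::3 set). M * m)"
      using F m by (intro prod_mono) (auto simp: cell_def mem_box_cart side_length_def intro: order_trans)
    finally have "measure lborel S \<le> (M * m) ^ 3" by (simp add: power3_eq_cube)
    then show ?thesis
      using that by (simp add: set_lebesgue_integral_def mult.commute mult_left_mono)
  qed
  have cmp: "(LINT X:S|lborel. f X) \<le> 2 * (LINT X:S|lborel. g X) + c * (M * m) ^ 3"
    if fg: "continuous_on UNIV f" "continuous_on UNIV g" "\<And>X. X \<in> S \<Longrightarrow> f X \<le> 2 * g X + c" "0 \<le> c"
    for f g :: "real^3 \<Rightarrow> real" and c
  proof -
    have "(LINT X:S|lborel. f X) \<le> (LINT X:S|lborel. 2 * g X + c)"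
      by (intro set_integral_mono int fg continuous_intros)
    also have "\<dots> = 2 * (LINT X:S|lborel. g X) + (LINT X:S|lborel. c)"
      using int[OF fg(2)] int[OF continuous_on_const[of _ c]] by (simp add: set_integral_add)
    finally show ?thesis using vol[OF fg(4)] by simp
  qed
  have "u \<in> cbox u (u + vec (m/800))" using m by (auto simp: mem_box_cart)
  then have u: "u \<in> cell T" using cube S by blast
  have Fu: "\<bar>F $ i - u $ i\<bar> \<le> M * m" for i
    using F u m(3)[of i] by (fastforce simp: cell_def mem_box_cart side_length_def abs_le_iff dest!: spec[of _ i])
  have val: "(q Y)\<^sup>2 * m ^ 3 \<le> K * (LINT X:S|lborel. (q X)\<^sup>2)"
    if q: "q \<in> Q1" and Y: "\<And>i. \<bar>Y $ i - u $ i\<bar> \<le> 2 * M * m" for q Y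
  proof -
    have "0 < m / 1600" using m by simp
    moreover have "\<bar>Y $ i - u $ i\<bar> \<le> 3200 * M * (m / 1600)" for i using Y[of i] by simp
    ultimately have "(q Y)\<^sup>2 * (m/1600) ^ 3 \<le>
        8 * (2 * (2 + 3200 * M)\<^sup>2) ^ 3 * (LINT X:cbox u (u + vec (2 * (m/1600)))|lborel. (q X)\<^sup>2)"
      by (rule Q1_value_le_L2_on_cube[OF q])
    then have "(q Y)\<^sup>2 * m ^ 3 \<le> K * (LINT X:cbox u (u + vec (m/800))|lborel. (q X)\<^sup>2)"
      by (simp add: K_def power_divide)
    also have "\<dots> \<le> K * (LINT X:S|lborel. (q X)\<^sup>2)"
    proof (intro mult_left_mono K)
      have c: "continuous_on A (\<lambda>X. (q X)\<^sup>2)" for A by (intro continuous_intros Q1_continuous q)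
      have i: "set_integrable lborel S (\<lambda>X. (q X)\<^sup>2)" by (rule int[OF c])
      then have "set_integrable lborel (cbox u (u + vec (m/800))) (\<lambda>X. (q X)\<^sup>2)"
        by (rule set_integrable_subset) (use cube in auto)
      with i show "(LINT X:cbox u (u + vec (m/800))|lborel. (q X)\<^sup>2) \<le> (LINT X:S|lborel. (q X)\<^sup>2)"
        unfolding set_lebesgue_integral_def set_integrable_def
        by (intro integral_mono) (use cube in \<open>auto simp: indicator_def\<close>)
    qed
    finally show ?thesis .
  qed
  have D2: "D\<^sup>2 \<le> (grad p F $ 1)\<^sup>2 + (grad p F $ 2)\<^sup>2 + (grad p F $ 3)\<^sup>2"
  proof -
    have "\<bar>D\<bar> \<le> norm (grad p F)"
      using Cauchy_Schwarz_ineq2[of "grad p F" n] n by (simp add: D_def)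
    then have "D\<^sup>2 \<le> (norm (grad p F))\<^sup>2" by (metis abs_le_square_iff abs_norm_cancel)
    also have "\<dots> = (grad p F $ 1)\<^sup>2 + (grad p F $ 2)\<^sup>2 + (grad p F $ 3)\<^sup>2"
      unfolding power2_norm_eq_inner inner_vec_def sum_3 by (simp add: power2_eq_square)
    finally show ?thesis .
  qed
  have k2: "k\<^sup>2 \<le> s\<^sup>2" "1 \<le> s\<^sup>2" using s by (auto simp: abs_le_square_iff[symmetric])
  have finish: "sqrt a \<le> sqrt (stability_const M) * s * sqrt b"
    if "a \<le> 2 * b + 72 * k\<^sup>2 * M ^ 5 * (K * b)" "0 \<le> b" for a b
  proof -
    have "2 * b \<le> s\<^sup>2 * (2 * b)" using k2 that(2) by (simp add: mult_le_cancel_right1)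
    moreover have "72 * k\<^sup>2 * M ^ 5 * (K * b) \<le> 72 * s\<^sup>2 * M ^ 5 * (K * b)"
      using k2 that(2) m K by (intro mult_right_mono mult_left_mono) auto
    ultimately have "a \<le> stability_const M * s\<^sup>2 * b"
      using that(1) by (simp add: sc algebra_simps)
    then have "sqrt a \<le> sqrt (stability_const M * s\<^sup>2 * b)" by (rule real_sqrt_le_mono)
    then show ?thesis using s by (simp add: real_sqrt_mult)
  qed
  have gradF: "(grad p F $ i)\<^sup>2 * m ^ 5 \<le> 4 * K * (LINT X:S|lborel. (p X)\<^sup>2)" for i
  proof -
    let ?I = "LINT X:S|lborel. (p X)\<^sup>2"
    have "\<bar>(F + m *\<^sub>R axis i 1) $ l - u $ l\<bar> \<le> 2 * M * m" for l
    proof -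
      define t where "t = (if l = i then m else 0)"
      have "0 \<le> t" "t \<le> M * m" using m by (auto simp: t_def)
      moreover have "(F + m *\<^sub>R axis i 1) $ l - u $ l = F $ l - u $ l + t"
        by (simp add: axis_def t_def)
      ultimately show ?thesis using Fu[of l] unfolding mult.assoc by linarith
    qed
    then have 1: "(p (F + m *\<^sub>R axis i 1))\<^sup>2 * m ^ 3 \<le> K * ?I" by (intro val p)
    have "\<bar>F $ l - u $ l\<bar> \<le> 2 * M * m" for l
    proof -
      have "0 \<le> M * m" using m by simp
      then show ?thesis using Fu[of l] by simp
    qed
    then have 2: "(p F)\<^sup>2 * m ^ 3 \<le> K * ?I" by (intro val p)
    have "m * grad p F $ i = p (F + m *\<^sub>R axis i 1) + - p F"
      using Q1_partial(2)[OF p, of F m i] by simp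
    then have "(m * grad p F $ i)\<^sup>2 \<le> 2 * (p (F + m *\<^sub>R axis i 1))\<^sup>2 + 2 * (p F)\<^sup>2"
      using square_sum_le[of "p (F + m *\<^sub>R axis i 1)" "- p F"] by simp
    then have "(m * grad p F $ i)\<^sup>2 * m ^ 3 \<le> (2 * (p (F + m *\<^sub>R axis i 1))\<^sup>2 + 2 * (p F)\<^sup>2) * m ^ 3"
      using m by (intro mult_right_mono) auto
    also have "\<dots> \<le> 4 * K * ?I" using 1 2 by (simp add: algebra_simps)
    finally show ?thesis by (simp add: power_mult_distrib algebra_simps flip: power_add)
  qed
  have nonneg: "0 \<le> (LINT X:S|lborel. f X)" if "\<And>X. 0 \<le> f X" for f :: "real^3 \<Rightarrow> real"
    unfolding set_lebesgue_integral_def using that by (intro Bochner_Integration.integral_nonneg) auto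
  have cp: "continuous_on A p" for A by (rule Q1_continuous[OF p])
  have cg: "continuous_on A (\<lambda>X. grad p X $ i)" for A i by (rule Q1_continuous[OF Q1_partial(1)[OF p]])
  have cgrad: "continuous_on A (grad p)" for A
    using cg by (subst continuous_on_componentwise) (auto simp: Basis_vec_def inner_axis)
  show ?thesis
  proof (cases "j = 0")
    case True
    let ?I = "LINT X:S|lborel. (p X)\<^sup>2"
    define c where "c = 6 * k\<^sup>2 * D\<^sup>2 * (M * m)\<^sup>2"
    have "(LINT X:S|lborel. (p X + k * D * ((X - F) \<bullet> n))\<^sup>2) \<le> 2 * ?I + c * (M * m) ^ 3"
    proof (rule cmp)
      fix X assume "X \<in> S"
      then have X: "X \<in> cell T" using S by blast
      have XF: "((X - F) $ i)\<^sup>2 \<le> (M * m)\<^sup>2" for i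
      proof -
        have "\<bar>(X - F) $ i\<bar> \<le> M * m"
          using F X m(3)[of i] by (fastforce simp: cell_def mem_box_cart side_length_def abs_le_iff dest!: spec[of _ i])
        then show ?thesis using m by (intro power2_le_iff_abs_le[THEN iffD2]) auto
      qed
      have "\<bar>(X - F) \<bullet> n\<bar> \<le> norm (X - F)" using Cauchy_Schwarz_ineq2[of "X - F" n] n by simp
      then have "((X - F) \<bullet> n)\<^sup>2 \<le> (norm (X - F))\<^sup>2" by (metis abs_le_square_iff abs_norm_cancel)
      also have "\<dots> = ((X - F) $ 1)\<^sup>2 + ((X - F) $ 2)\<^sup>2 + ((X - F) $ 3)\<^sup>2"
        unfolding power2_norm_eq_inner inner_vec_def sum_3 by (simp add: power2_eq_square)
      finally have "((X - F) \<bullet> n)\<^sup>2 \<le> 3 * (M * m)\<^sup>2" using XF[of 1] XF[of 2] XF[of 3] by linarith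
      then have "(k\<^sup>2 * D\<^sup>2) * ((X - F) \<bullet> n)\<^sup>2 \<le> (k\<^sup>2 * D\<^sup>2) * (3 * (M * m)\<^sup>2)"
        by (intro mult_left_mono) auto
      then show "(p X + k * D * ((X - F) \<bullet> n))\<^sup>2 \<le> 2 * (p X)\<^sup>2 + c"
        using square_sum_le[of "p X" "k * D * ((X - F) \<bullet> n)"]
        by (simp add: c_def power_mult_distrib)
    qed (auto simp: c_def intro!: continuous_intros cp)
    also have "c * (M * m) ^ 3 = 6 * k\<^sup>2 * M ^ 5 * (D\<^sup>2 * m ^ 5)"
      by (simp add: c_def power2_eq_square power3_eq_cube eval_nat_numeral)
    also have "\<dots> \<le> 6 * k\<^sup>2 * M ^ 5 * (12 * K * ?I)"
    proof (intro mult_left_mono)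
      have "D\<^sup>2 * m ^ 5 \<le> ((grad p F $ 1)\<^sup>2 + (grad p F $ 2)\<^sup>2 + (grad p F $ 3)\<^sup>2) * m ^ 5"
        using D2 m by (intro mult_right_mono) auto
      also have "\<dots> \<le> 12 * K * ?I"
        using gradF[of 1] gradF[of 2] gradF[of 3] by (simp add: algebra_simps)
      finally show "D\<^sup>2 * m ^ 5 \<le> 12 * K * ?I" .
    qed (use m in auto)
    finally have "(LINT X:S|lborel. (p X + k * D * ((X - F) \<bullet> n))\<^sup>2)
        \<le> 2 * ?I + 72 * k\<^sup>2 * M ^ 5 * (K * ?I)" by (simp add: algebra_simps)
    from finish[OF this nonneg] show ?thesis by (simp add: H_seminorm_def True D_def)
  next
    case False
    with j have j1: "j = 1" by simp
    let ?I = "LINT X:S|lborel. (norm (grad p X))\<^sup>2"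
    have g: "grad (\<lambda>X. p X + k * D * ((X - F) \<bullet> n)) X = grad p X + (k * D) *\<^sub>R n" for X
    proof (rule grad_unique)
      have "((\<lambda>X. (k * D) * ((X - F) \<bullet> n)) has_derivative (\<lambda>v. (k * D) * (v \<bullet> n))) (at X)"
        by (auto intro!: derivative_eq_intros)
      from has_derivative_add[OF Q1_has_grad[OF p] this]
      show "((\<lambda>X. p X + k * D * ((X - F) \<bullet> n)) has_derivative (\<lambda>v. (grad p X + (k * D) *\<^sub>R n) \<bullet> v)) (at X)"
        by (simp add: inner_add_left inner_add_right inner_commute)
    qed
    have "(LINT X:S|lborel. (norm (grad p X + (k * D) *\<^sub>R n))\<^sup>2) \<le> 2 * ?I + (2 * k\<^sup>2 * D\<^sup>2) * (M * m) ^ 3"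
    proof (rule cmp)
      fix X
      have "norm (grad p X + (k * D) *\<^sub>R n) \<le> norm (grad p X) + \<bar>k * D\<bar>"
        using norm_triangle_ineq[of "grad p X" "(k * D) *\<^sub>R n"] n by simp
      then have "(norm (grad p X + (k * D) *\<^sub>R n))\<^sup>2 \<le> (norm (grad p X) + \<bar>k * D\<bar>)\<^sup>2"
        by (intro power_mono) auto
      also have "\<dots> \<le> 2 * (norm (grad p X))\<^sup>2 + 2 * k\<^sup>2 * D\<^sup>2"
        using square_sum_le[of "norm (grad p X)" "\<bar>k * D\<bar>"] by (simp add: power_mult_distrib)
      finally show "(norm (grad p X + (k * D) *\<^sub>R n))\<^sup>2 \<le> 2 * (norm (grad p X))\<^sup>2 + 2 * k\<^sup>2 * D\<^sup>2" .
    qed (auto intro!: continuous_intros cgrad)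
    also have "(2 * k\<^sup>2 * D\<^sup>2) * (M * m) ^ 3 = 2 * k\<^sup>2 * M ^ 3 * (D\<^sup>2 * m ^ 3)"
      by (simp add: power_mult_distrib)
    also have "\<dots> \<le> 2 * k\<^sup>2 * M ^ 3 * (K * ?I)"
    proof (intro mult_left_mono)
      have "\<bar>F $ l - u $ l\<bar> \<le> 2 * M * m" for l
      proof -
        have "0 \<le> M * m" using m by simp
        then show ?thesis using Fu[of l] by simp
      qed
      then have gi: "(grad p F $ i)\<^sup>2 * m ^ 3 \<le> K * (LINT X:S|lborel. (grad p X $ i)\<^sup>2)" for i
        by (intro val Q1_partial p)
      have "D\<^sup>2 * m ^ 3 \<le> ((grad p F $ 1)\<^sup>2 + (grad p F $ 2)\<^sup>2 + (grad p F $ 3)\<^sup>2) * m ^ 3"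
        using D2 m by (intro mult_right_mono) auto
      also have "\<dots> \<le> K * (\<Sum>i\<in>UNIV. (LINT X:S|lborel. (grad p X $ i)\<^sup>2))"
        using gi[of 1] gi[of 2] gi[of 3] unfolding sum_3 by (simp add: algebra_simps)
      also have "(\<Sum>i\<in>UNIV. (LINT X:S|lborel. (grad p X $ i)\<^sup>2)) = (LINT X:S|lborel. (\<Sum>i\<in>UNIV. (grad p X $ i)\<^sup>2))"
        by (intro set_integral_sum(2)[symmetric] int continuous_intros cg)
      also have "(\<lambda>X. \<Sum>i\<in>UNIV. (grad p X $ i)\<^sup>2) = (\<lambda>X. (norm (grad p X))\<^sup>2)"
        unfolding power2_norm_eq_inner inner_vec_def by (simp add: power2_eq_square)
      finally show "D\<^sup>2 * m ^ 3 \<le> K * ?I" .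
    qed (use m in auto)
    also have "\<dots> \<le> 72 * k\<^sup>2 * M ^ 5 * (K * ?I)"
      using m K power_increasing[of 3 5 M] nonneg[of "\<lambda>X. (norm (grad p X))\<^sup>2"]
      by (intro mult_right_mono mult_mono) auto
    finally have "(LINT X:S|lborel. (norm (grad p X + (k * D) *\<^sub>R n))\<^sup>2)
        \<le> 2 * ?I + 72 * k\<^sup>2 * M ^ 5 * (K * ?I)" by simp
    from finish[OF this nonneg] show ?thesis
      by (simp add: H_seminorm_def j1 g[unfolded D_def] D_def)
  qed
qed

section \<open>Vertices of type III and type V elements\<close>

lemma closed_segment_far_from_end:
  fixes P Q D :: "'a::real_normed_vector"
  assumes "D \<in> closed_segment P Q" "dist Q D \<le> 1/2 * dist Q P" "P \<noteq> Q"
  obtains c where "D = P + c *\<^sub>R (Q - P)" "1/2 \<le> c"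
proof -
  obtain c where c: "0 \<le> c" "c \<le> 1" "D = (1 - c) *\<^sub>R P + c *\<^sub>R Q"
    using assms(1) by (auto simp: closed_segment_def)
  have "Q - D = (1 - c) *\<^sub>R (Q - P)" by (simp add: c algebra_simps)
  then have "(1 - c) * dist Q P \<le> 1/2 * dist Q P"
    using assms(2) c by (simp add: dist_norm)
  then have "1/2 \<le> c" using assms(3) by simp
  moreover have "D = P + c *\<^sub>R (Q - P)" by (simp add: c algebra_simps)
  ultimately show ?thesis using that by blast
qed

text \<open>The set \<open>E\<close> will be the closed side of the vertex, including the surface. The sign of \<open>t\<close> is left
  open, because membership in the cell determines it.\<close>

definition half_edges_in :: "cuboid \<Rightarrow> (real^3) set \<Rightarrow> real^3 \<Rightarrow> bool" where
  "half_edges_in T E V \<longleftrightarrow>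
     (\<forall>i. \<exists>t. V + t *\<^sub>R axis i 1 \<in> cell T \<inter> E \<and> side_length T i / 2 \<le> \<bar>t\<bar>)"

lemma vertices_subset_cell:
  assumes "\<And>i. 0 < side_length T i"
  shows "vertices T \<subseteq> cell T"
proof
  fix x assume x: "x \<in> vertices T"
  have "fst T $ i \<le> x $ i \<and> x $ i \<le> snd T $ i" for i
    using x assms[of i] by (auto simp: vertices_def side_length_def dest!: spec[of _ i])
  then show "x \<in> cell T" by (auto simp: cell_def mem_box_cart)
qed

lemma edges_subset_cell:
  assumes "\<And>i. 0 < side_length T i"
  shows "edge_points \<Gamma> T \<subseteq> cell T \<inter> \<Gamma>"
proof -
  have "closed_segment x y \<subseteq> cell T" if "x \<in> vertices T" "y \<in> vertices T" for x y
    using that vertices_subset_cell[of T] assms unfolding cell_def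
    by (intro closed_segment_subset convex_box) auto
  then show ?thesis unfolding edge_points_def edges_def by blast
qed

text \<open>For type V the vertex is \<open>A 1\<close>, all of whose neighbours are in \<open>T1\<close>. For type III the vertices
  \<open>A 1, A 3, A 5, A 7\<close> of one face are in \<open>T1\<close>, and the cut edge that is cut in its outer half
  starts at one of them: its two neighbours in the face and the intersection point on the cut
  edge are the three required points.\<close>

lemma vertex_with_half_edges:
  assumes lab: "vertex_labelling T A" and pos: "\<And>i. 0 < side_length T i"
    and T1: "T1 \<subseteq> cell T \<inter> E" and \<Gamma>: "\<Gamma> \<subseteq> E"
    and type: "type_III \<Gamma> T T1 T2 A D \<and>
        (dist (A 4) (D 4) \<le> 1/2 * dist (A 4) (A 3) \<or>
         dist (A 2) (D 1) \<le> 1/2 * dist (A 2) (A 1) \<or>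
         dist (A 6) (D 2) \<le> 1/2 * dist (A 6) (A 5) \<or>
         dist (A 8) (D 3) \<le> 1/2 * dist (A 8) (A 7))
      \<or> type_V \<Gamma> T T1 T2 A"
  shows "\<exists>V\<in>vertices T \<inter> T1. half_edges_in T E V"
proof -
  obtain \<pi> :: "3 \<Rightarrow> 3" and e :: "3 \<Rightarrow> real^3" and l :: "3 \<Rightarrow> real" where \<pi>: "bij \<pi>"
    and e: "\<And>m. e m = axis (\<pi> m) 1 \<or> e m = - axis (\<pi> m) (1::real)"
    and l: "\<And>m. l m = side_length T (\<pi> m)"
    and A2: "A 2 = A 1 + l 1 *\<^sub>R e 1" and A3: "A 3 = A 1 + l 2 *\<^sub>R e 2"
    and A4: "A 4 = A 1 + l 1 *\<^sub>R e 1 + l 2 *\<^sub>R e 2"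
    and A58: "\<forall>k\<in>{1..4}. A (k + 4) = A k + l 3 *\<^sub>R e 3"
    using lab unfolding vertex_labelling_def by metis
  have A5: "A 5 = A 1 + l 3 *\<^sub>R e 3" and A6: "A 6 = A 2 + l 3 *\<^sub>R e 3"
    and A7: "A 7 = A 3 + l 3 *\<^sub>R e 3" and A8: "A 8 = A 4 + l 3 *\<^sub>R e 3"
    using A58[rule_format, of 1] A58[rule_format, of 2] A58[rule_format, of 3] A58[rule_format, of 4]
    by auto
  have Av: "A k \<in> vertices T" if "k \<in> {1..8}" for k
    using lab that unfolding vertex_labelling_def by blast
  have half: "half_edges_in T E V"
    if N: "N1 = V + x *\<^sub>R (l 1 *\<^sub>R e 1)" "N2 = V + y *\<^sub>R (l 2 *\<^sub>R e 2)" "N3 = V + z *\<^sub>R (l 3 *\<^sub>R e 3)"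
      and "N1 \<in> cell T \<inter> E" "N2 \<in> cell T \<inter> E" "N3 \<in> cell T \<inter> E"
      and xyz: "1/2 \<le> \<bar>x\<bar>" "1/2 \<le> \<bar>y\<bar>" "1/2 \<le> \<bar>z\<bar>" for V N1 N2 N3 x y z
    unfolding half_edges_in_def
  proof
    fix i
    obtain m where m: "\<pi> m = i" using bij_is_surj[OF \<pi>] by (metis surjD)
    have "\<exists>c. V + c *\<^sub>R (l m *\<^sub>R e m) \<in> cell T \<inter> E \<and> 1/2 \<le> \<bar>c\<bar>"
      using exhaust_3[of m] that by blast
    then obtain c where c: "V + c *\<^sub>R (l m *\<^sub>R e m) \<in> cell T \<inter> E" "1/2 \<le> \<bar>c\<bar>" by blast
    obtain \<epsilon> where \<epsilon>: "\<bar>\<epsilon>\<bar> = 1" "e m = \<epsilon> *\<^sub>R axis i 1"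
      using e[of m] m by (metis abs_1 abs_minus_cancel scaleR_minus1_left scaleR_one)
    have "side_length T i / 2 \<le> \<bar>c * l m * \<epsilon>\<bar>"
      using c(2) pos[of i] \<epsilon>(1) mult_right_mono[of "1/2" "\<bar>c\<bar>" "side_length T i"]
      by (simp add: abs_mult l m)
    then show "\<exists>t. V + t *\<^sub>R axis i 1 \<in> cell T \<inter> E \<and> side_length T i / 2 \<le> \<bar>t\<bar>"
      using c(1) \<epsilon>(2) by (intro exI[of _ "c * l m * \<epsilon>"]) (simp add: mult.assoc)
  qed
  show ?thesis
    using type
  proof (elim disjE conjE)
    assume "type_V \<Gamma> T T1 T2 A"
    then have mem: "A 1 \<in> T1" "A 2 \<in> T1" "A 3 \<in> T1" "A 5 \<in> T1" by (auto simp: type_V_def)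
    have "half_edges_in T E (A 1)"
      by (rule half[of "A 2" _ 1 "A 3" 1 "A 5" 1]) (use mem T1 in \<open>auto simp: A2 A3 A5\<close>)
    then show ?thesis using mem Av[of 1] by auto
  next
    assume t3: "type_III \<Gamma> T T1 T2 A D"
    then have mem: "A 1 \<in> cell T \<inter> E" "A 3 \<in> cell T \<inter> E" "A 5 \<in> cell T \<inter> E" "A 7 \<in> cell T \<inter> E"
      using T1 by (auto simp: type_III_def)
    have mem1: "A 1 \<in> vertices T \<inter> T1" "A 3 \<in> vertices T \<inter> T1" "A 5 \<in> vertices T \<inter> T1" "A 7 \<in> vertices T \<inter> T1"
      using t3 Av by (auto simp: type_III_def)
    have D: "D k \<in> cell T \<inter> E" if "k \<in> {1,2,3,4}" for k
      using t3 that edges_subset_cell[OF pos, of \<Gamma>] \<Gamma> unfolding type_III_def by blast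
    have seg: "D 1 \<in> closed_segment (A 1) (A 2)" "D 2 \<in> closed_segment (A 5) (A 6)"
      "D 3 \<in> closed_segment (A 7) (A 8)" "D 4 \<in> closed_segment (A 3) (A 4)"
      using t3 by (auto simp: type_III_def)
    have "l 1 *\<^sub>R e 1 \<noteq> 0" using l[of 1] pos[of "\<pi> 1"] e[of 1] by (auto simp: axis_eq_0_iff)
    have diff: "A 2 - A 1 = l 1 *\<^sub>R e 1" "A 6 - A 5 = l 1 *\<^sub>R e 1"
      "A 8 - A 7 = l 1 *\<^sub>R e 1" "A 4 - A 3 = l 1 *\<^sub>R e 1"
      by (simp_all add: A2 A3 A4 A5 A6 A7 A8)
    then have ne: "A 1 \<noteq> A 2" "A 5 \<noteq> A 6" "A 7 \<noteq> A 8" "A 3 \<noteq> A 4"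
      using \<open>l 1 *\<^sub>R e 1 \<noteq> 0\<close> by auto
    {
      assume "dist (A 4) (D 4) \<le> 1/2 * dist (A 4) (A 3)"
      then obtain c where c: "D 4 = A 3 + c *\<^sub>R (A 4 - A 3)" "1/2 \<le> c"
        using closed_segment_far_from_end[OF seg(4) _ ne(4)] by blast
      have "half_edges_in T E (A 3)"
      proof (rule half[OF _ _ _ D[of 4] mem(1) mem(4)])
        show "D 4 = A 3 + c *\<^sub>R (l 1 *\<^sub>R e 1)" using c(1) by (simp only: diff)
        show "A 1 = A 3 + (-1) *\<^sub>R (l 2 *\<^sub>R e 2)" "A 7 = A 3 + 1 *\<^sub>R (l 3 *\<^sub>R e 3)"
          by (simp_all add: A3 A5 A7)
      qed (use c(2) in auto)
      then show ?thesis using mem1 by blast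
    }
    {
      assume "dist (A 2) (D 1) \<le> 1/2 * dist (A 2) (A 1)"
      then obtain c where c: "D 1 = A 1 + c *\<^sub>R (A 2 - A 1)" "1/2 \<le> c"
        using closed_segment_far_from_end[OF seg(1) _ ne(1)] by blast
      have "half_edges_in T E (A 1)"
      proof (rule half[OF _ _ _ D[of 1] mem(2) mem(3)])
        show "D 1 = A 1 + c *\<^sub>R (l 1 *\<^sub>R e 1)" using c(1) by (simp only: diff)
        show "A 3 = A 1 + 1 *\<^sub>R (l 2 *\<^sub>R e 2)" "A 5 = A 1 + 1 *\<^sub>R (l 3 *\<^sub>R e 3)"
          by (simp_all add: A3 A5 A7)
      qed (use c(2) in auto)
      then show ?thesis using mem1 by blast
    }
    {
      assume "dist (A 6) (D 2) \<le> 1/2 * dist (A 6) (A 5)"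
      then obtain c where c: "D 2 = A 5 + c *\<^sub>R (A 6 - A 5)" "1/2 \<le> c"
        using closed_segment_far_from_end[OF seg(2) _ ne(2)] by blast
      have "half_edges_in T E (A 5)"
      proof (rule half[OF _ _ _ D[of 2] mem(4) mem(1)])
        show "D 2 = A 5 + c *\<^sub>R (l 1 *\<^sub>R e 1)" using c(1) by (simp only: diff)
        show "A 7 = A 5 + 1 *\<^sub>R (l 2 *\<^sub>R e 2)" "A 1 = A 5 + (-1) *\<^sub>R (l 3 *\<^sub>R e 3)"
          by (simp_all add: A3 A5 A7)
      qed (use c(2) in auto)
      then show ?thesis using mem1 by blast
    }
    {
      assume "dist (A 8) (D 3) \<le> 1/2 * dist (A 8) (A 7)"
      then obtain c where c: "D 3 = A 7 + c *\<^sub>R (A 8 - A 7)" "1/2 \<le> c"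
        using closed_segment_far_from_end[OF seg(3) _ ne(3)] by blast
      have "half_edges_in T E (A 7)"
      proof (rule half[OF _ _ _ D[of 3] mem(3) mem(2)])
        show "D 3 = A 7 + c *\<^sub>R (l 1 *\<^sub>R e 1)" using c(1) by (simp only: diff)
        show "A 5 = A 7 + (-1) *\<^sub>R (l 2 *\<^sub>R e 2)" "A 3 = A 7 + (-1) *\<^sub>R (l 3 *\<^sub>R e 3)"
          by (simp_all add: A3 A5 A7)
      qed (use c(2) in auto)
      then show ?thesis using mem1 by blast
    }
  qed
qed

section \<open>Cells of a Cartesian mesh\<close>

lemma cartesian_mesh_cell:
  assumes "cartesian_mesh a b \<T>" "T \<in> \<T>"
  shows "0 < side_length T i" and "cell T \<subseteq> cbox a b" and "side_length T i \<le> mesh_size \<T>"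
proof -
  obtain G where G: "\<And>i. finite (G i)" "\<And>i. G i \<subseteq> {a $ i..b $ i}" and \<T>: "\<T> = grid_cells G"
    using assms(1) unfolding cartesian_mesh_def by blast
  have T: "fst T $ i \<in> G i \<and> snd T $ i \<in> G i \<and> fst T $ i < snd T $ i" for i
    using assms(2) by (auto simp: \<T> grid_cells_def)
  show "0 < side_length T i" using T by (simp add: side_length_def)
  have *: "a $ i \<le> fst T $ i \<and> snd T $ i \<le> b $ i" for i
    using T[of i] G(2)[of i] by auto
  then show "cell T \<subseteq> cbox a b"
    by (force simp: cell_def mem_box_cart intro: order_trans[OF conjunct1[OF *]] order_trans[OF _ conjunct2[OF *]])
  have "{side_length T i | T i. T \<in> \<T>} \<subseteq> (\<Union>i. (\<lambda>(x, y). y - x) ` (G i \<times> G i))"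
    by (fastforce simp: \<T> grid_cells_def side_length_def)
  then have "finite {side_length T i | T i. T \<in> \<T>}"
    by (rule finite_subset) (use G(1) in auto)
  then show "side_length T i \<le> mesh_size \<T>"
    unfolding mesh_size_def using assms(2) by (intro Max_ge) blast+
qed

text \<open>\<open>3 sqrt 3 > 5\<close>, so every cell side is at most a fifth of a radius for which the normal segments are
  disjoint.\<close>

lemma reach_gives_radius:
  assumes "ereal h < reach \<Gamma> / ereal (3 * sqrt 3)" "0 < h"
  obtains r where "5 * h \<le> r" "normals_disjoint \<Gamma> r"
proof -
  have "ereal (3 * sqrt 3) * ereal h < reach \<Gamma>"
    using assms(1) by (subst (asm) ereal_less_divide_pos) auto
  then obtain r where r: "ereal (3 * sqrt 3 * h) < ereal r" "normals_disjoint \<Gamma> r"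
    unfolding reach_def less_Sup_iff normals_disjoint_def by auto
  have "5/3 \<le> sqrt 3" by (rule real_le_rsqrt) (simp add: power2_eq_square)
  then have "5 * h \<le> 3 * sqrt 3 * h" using assms(2) by (intro mult_right_mono) auto
  then show ?thesis using r by (intro that[of r]) auto
qed

lemma subelement_in_borel:
  assumes "closed_C2_surface \<Gamma>"
  shows "subelement \<Gamma> S T \<in> sets borel"
proof -
  have "closed \<Gamma>" using assms by (simp add: closed_C2_surface_def compact_imp_closed)
  then show ?thesis unfolding subelement_def side_def cell_def
    by (intro sets.Int sets.Diff borel_closed closed_cbox closed_closure)
qed

section \<open>Uniform stability\<close>

theorem lemma4p4:
  fixes \<sigma> :: real
  shows "\<exists>C>0. \<forall>a b \<Gamma> \<Omega>m \<Omega>p \<T> \<beta>m \<beta>p T S1 S2 A D P1 P2 P3 n.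
    interface_domain a b \<Gamma> \<Omega>m \<Omega>p \<longrightarrow>
    0 < \<beta>m \<and> \<beta>m \<le> \<beta>p \<longrightarrow>
    cartesian_mesh a b \<T> \<and> shape_regular \<sigma> \<T> \<and> mesh_assumptions \<Gamma> \<T> \<longrightarrow>
    T \<in> \<T> \<and> interface_element \<Gamma> \<Omega>m \<Omega>p T \<and> vertex_labelling T A \<longrightarrow>
    (S1 = \<Omega>m \<and> S2 = \<Omega>p) \<or> (S1 = \<Omega>p \<and> S2 = \<Omega>m) \<longrightarrow>
    (let T1 = subelement \<Gamma> S1 T; T2 = subelement \<Gamma> S2 T; F = centroid P1 P2 P3 in
      (type_III \<Gamma> T T1 T2 A D \<and>
        (dist (A 4) (D 4) \<le> 1/2 * dist (A 4) (A 3) \<or>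
         dist (A 2) (D 1) \<le> 1/2 * dist (A 2) (A 1) \<or>
         dist (A 6) (D 2) \<le> 1/2 * dist (A 6) (A 5) \<or>
         dist (A 8) (D 3) \<le> 1/2 * dist (A 8) (A 7)) \<and>
        P1 = D 1 \<and> P2 = D 4 \<and> P3 = D 3
       \<or> type_V \<Gamma> T T1 T2 A \<and>
        {P1, P2, P3} \<subseteq> edge_points \<Gamma> T \<and> \<not> collinear {P1, P2, P3} \<and>
        max_angle_le P1 P2 P3 (3 * pi / 4)) \<longrightarrow>
      plane_normal (affine hull {P1, P2, P3}) n \<longrightarrow>
      (\<forall>j\<in>{0, 1}. \<forall>p\<in>Q1.
        H_seminorm j T1 (C_op \<beta>m \<beta>p F n p) \<le> C * H_seminorm j T1 p \<and>
        H_seminorm j T1 (C_op_inv \<beta>m \<beta>p F n p) \<le> C * (\<beta>p / \<beta>m) * H_seminorm j T1 p))"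
proof (intro exI[of _ "sqrt (stability_const ((\<sigma>\<^sup>2)))"] conjI allI impI)
  show "0 < sqrt (stability_const (\<sigma>\<^sup>2))"
    unfolding stability_const_def by (simp add: add_pos_nonneg)
  fix a b \<Gamma> \<Omega>m \<Omega>p \<T> and \<beta>m \<beta>p :: real and T S1 S2 A D P1 P2 P3 n
  assume dom: "interface_domain a b \<Gamma> \<Omega>m \<Omega>p" and \<beta>: "0 < \<beta>m \<and> \<beta>m \<le> \<beta>p"
    and mesh: "cartesian_mesh a b \<T> \<and> shape_regular \<sigma> \<T> \<and> mesh_assumptions \<Gamma> \<T>"
    and T: "T \<in> \<T> \<and> interface_element \<Gamma> \<Omega>m \<Omega>p T \<and> vertex_labelling T A"
    and S: "(S1 = \<Omega>m \<and> S2 = \<Omega>p) \<or> (S1 = \<Omega>p \<and> S2 = \<Omega>m)"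
  define T1 where "T1 = subelement \<Gamma> S1 T"
  define T2 where "T2 = subelement \<Gamma> S2 T"
  define F where "F = centroid P1 P2 P3"
  have "H_seminorm j T1 (C_op \<beta>m \<beta>p F n p) \<le> sqrt (stability_const (\<sigma>\<^sup>2)) * H_seminorm j T1 p \<and>
      H_seminorm j T1 (C_op_inv \<beta>m \<beta>p F n p)
        \<le> sqrt (stability_const (\<sigma>\<^sup>2)) * (\<beta>p / \<beta>m) * H_seminorm j T1 p"
    if type: "type_III \<Gamma> T T1 T2 A D \<and>
        (dist (A 4) (D 4) \<le> 1/2 * dist (A 4) (A 3) \<or>
         dist (A 2) (D 1) \<le> 1/2 * dist (A 2) (A 1) \<or>
         dist (A 6) (D 2) \<le> 1/2 * dist (A 6) (A 5) \<or>
         dist (A 8) (D 3) \<le> 1/2 * dist (A 8) (A 7)) \<and>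
        P1 = D 1 \<and> P2 = D 4 \<and> P3 = D 3
       \<or> type_V \<Gamma> T T1 T2 A \<and>
        {P1, P2, P3} \<subseteq> edge_points \<Gamma> T \<and> \<not> collinear {P1, P2, P3} \<and>
        max_angle_le P1 P2 P3 (3 * pi / 4)"
      and nrm: "plane_normal (affine hull {P1, P2, P3}) n" and j: "j \<in> {0, 1}" and p: "p \<in> Q1" for j p
  proof -
    have cell: "0 < side_length T i" "cell T \<subseteq> cbox a b" "side_length T i \<le> mesh_size \<T>" for i
      using cartesian_mesh_cell mesh T by blast+
    define len where "len = side_length T"
    have reg: "len i \<le> \<sigma> * len k" and len0: "0 < len i" for i k
      using mesh T cell by (auto simp: shape_regular_def len_def)
    have \<sigma>: "1 \<le> \<sigma>" using reg[of 1 1] len0[of 1] by simp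
    \<comment> \<open>all sides of the cell lie between \<open>m\<close> and \<open>\<sigma>\<^sup>2 m\<close>\<close>
    define m where "m = len 1 / \<sigma>"
    have m: "0 < m" using len0 \<sigma> by (simp add: m_def)
    have m_le: "m \<le> side_length T i" for i
      using reg[of 1 i] \<sigma> by (simp add: m_def len_def divide_le_eq mult.commute)
    have le_m: "side_length T i \<le> \<sigma>\<^sup>2 * m" for i
      using reg[of i 1] \<sigma> by (simp add: m_def len_def power2_eq_square)
    have surf: "closed_C2_surface \<Gamma>" "\<Gamma> \<subseteq> box a b" using dom by (auto simp: interface_domain_def)
    have ne: "box a b \<noteq> {}" using dom by (simp add: interface_domain_def interval_ne_empty_cart)
    have "0 < mesh_size \<T>" using cell(1)[of 1] cell(3)[of 1] by simp
    then obtain r where r: "5 * mesh_size \<T> \<le> r" "normals_disjoint \<Gamma> r"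
      using mesh reach_gives_radius unfolding mesh_assumptions_def by metis
    interpret separating_surface "box a b" \<Gamma> S1 S2 r
    proof
      show "0 < r" using r \<open>0 < mesh_size \<T>\<close> by simp
    qed (use dom S r surf in \<open>auto simp: interface_domain_def convex_box open_box\<close>)
    have ep: "edge_points \<Gamma> T \<subseteq> cell T \<inter> \<Gamma>" by (rule edges_subset_cell[OF cell(1)])
    have P: "{P1, P2, P3} \<subseteq> edge_points \<Gamma> T"
      using type by (auto simp: type_III_def)
    have "\<exists>V\<in>vertices T \<inter> T1. half_edges_in T (closure S1 \<union> \<Gamma>) V"
      by (rule vertex_with_half_edges[of T A T1 _ \<Gamma> T2 D])
        (use T cell type in \<open>auto simp: T1_def subelement_def side_def\<close>)
    then obtain V where V: "V \<in> vertices T" "V \<in> closure S1 - \<Gamma>" "half_edges_in T (closure S1 \<union> \<Gamma>) V"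
      by (auto simp: T1_def subelement_def side_def)
    have "\<exists>u. cbox u (u + vec (m/800)) \<subseteq> T1" unfolding T1_def
    proof (rule corner_contains_cube[OF _ V(1,2) _ m m_le])
      show "cell T \<subseteq> closure (box a b)" using cell(2) ne by (simp add: closure_box)
      show "\<Gamma> \<noteq> {}" using P ep by blast
      show "5 * side_length T i \<le> r" for i using cell(3)[of i] r(1) by linarith
    qed (use V(3) in \<open>auto simp: half_edges_in_def\<close>)
    then obtain u where u: "cbox u (u + vec (m/800)) \<subseteq> T1" ..
    have Pc: "P1 \<in> cell T" "P2 \<in> cell T" "P3 \<in> cell T" using P ep by auto
    have F: "F \<in> cell T"
    proof -
      have "fst T $ i \<le> F $ i \<and> F $ i \<le> snd T $ i" for i
      proof -
        have "fst T $ i \<le> Q $ i \<and> Q $ i \<le> snd T $ i" if "Q \<in> cell T" for Q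
          using that by (simp add: cell_def mem_box_cart)
        from this[OF Pc(1)] this[OF Pc(2)] this[OF Pc(3)] show ?thesis
          by (simp add: F_def centroid_def)
      qed
      then show ?thesis by (simp add: cell_def mem_box_cart)
    qed
    have n: "norm n = 1" using nrm by (simp add: plane_normal_def)
    note stable = extension_stable[OF p subelement_in_borel[OF surf(1)] _ u[unfolded T1_def] m _ le_m F n _ _ j,
        folded T1_def]
    have sub: "T1 \<subseteq> cell T" by (auto simp: T1_def subelement_def)
    have q: "1 \<le> \<beta>p / \<beta>m" "0 < \<beta>m / \<beta>p" "\<beta>m / \<beta>p \<le> 1" using \<beta> by auto
    have \<sigma>2: "1 \<le> \<sigma>\<^sup>2" using \<sigma> by simp
    have "H_seminorm j T1 (C_op \<beta>m \<beta>p F n p) \<le> sqrt (stability_const (\<sigma>\<^sup>2)) * 1 * H_seminorm j T1 p"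
      unfolding C_op_def by (rule stable[OF sub \<sigma>2]) (use q in auto)
    moreover have "H_seminorm j T1 (C_op_inv \<beta>m \<beta>p F n p)
        \<le> sqrt (stability_const (\<sigma>\<^sup>2)) * (\<beta>p / \<beta>m) * H_seminorm j T1 p"
      unfolding C_op_inv_def by (rule stable[OF sub \<sigma>2]) (use q in auto)
    ultimately show ?thesis by simp
  qed
  then show "let T1 = subelement \<Gamma> S1 T; T2 = subelement \<Gamma> S2 T; F = centroid P1 P2 P3 in
      (type_III \<Gamma> T T1 T2 A D \<and>
        (dist (A 4) (D 4) \<le> 1/2 * dist (A 4) (A 3) \<or>
         dist (A 2) (D 1) \<le> 1/2 * dist (A 2) (A 1) \<or>
         dist (A 6) (D 2) \<le> 1/2 * dist (A 6) (A 5) \<or>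
         dist (A 8) (D 3) \<le> 1/2 * dist (A 8) (A 7)) \<and>
        P1 = D 1 \<and> P2 = D 4 \<and> P3 = D 3
       \<or> type_V \<Gamma> T T1 T2 A \<and>
        {P1, P2, P3} \<subseteq> edge_points \<Gamma> T \<and> \<not> collinear {P1, P2, P3} \<and>
        max_angle_le P1 P2 P3 (3 * pi / 4)) \<longrightarrow>
      plane_normal (affine hull {P1, P2, P3}) n \<longrightarrow>
      (\<forall>j\<in>{0, 1}. \<forall>p\<in>Q1.
        H_seminorm j T1 (C_op \<beta>m \<beta>p F n p) \<le> sqrt (stability_const (\<sigma>\<^sup>2)) * H_seminorm j T1 p \<and>
        H_seminorm j T1 (C_op_inv \<beta>m \<beta>p F n p)
          \<le> sqrt (stability_const (\<sigma>\<^sup>2)) * (\<beta>p / \<beta>m) * H_seminorm j T1 p)"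
    unfolding Let_def T1_def[symmetric] T2_def[symmetric] F_def[symmetric] by blast
qed

end
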